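(* Suppose that the Markov chain $\{S_t\}_{t\ge0}$ induced by the given policy $\pi$ is irreducible for every $P\in\mathcal P_{\mathsf s}$, and let $\epsilon>0$. For every $m\in\mathbb Z_+$ let $\mathbb G_m=\langle\nabla_PV_\pi^{P^{(m)}}(s_0),P_\epsilon-P^{(m)}\rangle$, where $P_\epsilon$ denotes the $\epsilon$-optimal solution of the direction-finding subproblem computed in the $m$-th iteration of the Frank-Wolfe algorithm, and let the stepsizes be $\alpha_m=\mathbb G_m(1-\gamma)^3/(4\gamma^2)$. Then the Frank-Wolfe algorithm terminates within $\mathcal O(1/\epsilon^2)$ iterations (with hidden constant independent of $\epsilon$), and its output $\widehat P$ satisfies $$V_\pi^\star(s_0)-V_\pi^{\widehat P}(s_0)\ \le\ \delta_d\,(2\epsilon+\delta_{\mathcal P}).$$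
   Context: For a finite set $X$, $\Delta(X)$ denotes the probability simplex over $X$. Let $\mathcal S=\{1,\dots,S\}$ be a finite state space, $\mathcal A=\{1,\dots,A\}$ a finite action space, $\gamma\in(0,1)$ a discount factor, and $c:\mathcal S\times\mathcal A\to[0,1]$ a cost function. A transition kernel is $P\in\Delta(\mathcal S)^{S\times A}$ with entries $P(s'|s,a)$, and a stationary policy is $\pi\in\Pi=\Delta(\mathcal A)^S$ with entries $\pi(a|s)$. $\mathbb P_\pi^P$ and $\mathbb E_\pi^P$ denote probability and expectation for the process $(S_t,A_t)_{t\ge0}$ with $A_t\sim\pi(\cdot|S_t)$, $S_{t+1}\sim P(\cdot|S_t,A_t)$; under $\mathbb P_\pi^P$, $\{S_t\}$ is a Markov chain with transition probabilities $P_\pi(s,s')=\sum_aP(s'|s,a)\pi(a|s)$. The value function is $V_\pi^P(s)=\mathbb E_\pi^P[\sum_{t=0}^\infty\gamma^tc(S_t,A_t)\mid S_0=s]$. As a function of $P$ it is given by $(I-\gamma P_\pi)^{-1}c_\pi$ with $c_\pi(s)=\sum_a\pi(a|s)c(s,a)$, which is rational and extends to a neighborhood of $\Delta(\mathcal S)^{S\times A}$; $\nabla_PV_\pi^P(s_0)\in\mathbb R^{S\times S\times A}$ is the gradient with respect to the entries of $P$, and $\langle\cdot,\cdot\rangle$ is the Euclidean inner product. The policy $\pi\in\Pi$ and initial state $s_0\in\mathcal S$ are fixed. The uncertainty set is $\mathcal P=\{P^\xi:\xi\in\Xi\}\subseteq\Delta(\mathcal S)^{S\times A}$ with $\Xi\subseteq\mathbb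 R^q$ convex and compact and $\xi\mapsto P^\xi$ affine (so $\mathcal P$ is convex and compact). The worst-case value function is $V_\pi^\star(s_0)=\max_{P\in\mathcal P}V_\pi^P(s_0)$. A set of kernels is $s$-rectangular if it is of the form $\prod_{s\in\mathcal S}\mathcal P_s$ with $\mathcal P_s\subseteq\Delta(\mathcal S)^A$. $\mathcal P_{\mathsf s}$ denotes the smallest $s$-rectangular set containing $\mathcal P$. Discounted state visitation distribution: $d_\pi^P(s|s_0)=(1-\gamma)\sum_{t=0}^\infty\gamma^t\,\mathbb P_\pi^P(S_t=s\mid S_0=s_0)$. Distribution mismatch coefficient: $\delta_d=\max_{P,P'\in\mathcal P_{\mathsf s}}\max_{s\in\mathcal S}d_\pi^{P'}(s|s_0)/d_\pi^P(s|s_0)$. Degree of non-rectangularity: $\delta_{\mathcal P}=\max_{P'\in\mathcal P}\delta_{\mathcal P}(P')$ with $$\delta_{\mathcal P}(P')=\max_{P_{\mathsf s}\in\mathcal P_{\mathsf s}}\langle\nabla_PV_\pi^{P'}(s_0),P_{\mathsf s}\rangle-\max_{P\in\mathcal P}\langle\nabla_PV_\pi^{P'}(s_0),P\rangle.$$ Frank-Wolfe algorithm (inputs: $P^{(0)}\in\mathcal P$, positive stepsizes $\{\alpha_m\}$, tolerance $\epsilon>0$). In iteration $m=0,1,2,\dots$: (1) find an $\epsilon$-optimal solution $P_\epsilon\in\mathcal P$ of the direction-finding subproblem $\max_{P\in\mathcal P}\langle\nabla_PV_\pi^{P^{(m)}}(s_0),P-P^{(m)}\rangle$, i.e. its objective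 value is at least the maximum minus $\epsilon$; (2) if $\mathbb G_m=\langle\nabla_PV_\pi^{P^{(m)}}(s_0),P_\epsilon-P^{(m)}\rangle\le\epsilon$, terminate and output $\widehat P=P^{(m)}$; (3) otherwise set $P^{(m+1)}=(1-\alpha_m)P^{(m)}+\alpha_mP_\epsilon$ and continue with $m+1$.
   Formalization: For γ < 1/5 the formal theorem additionally assumes that every iterate P^(m) computed by the algorithm lies in 𝒫; the prescribed stepsize can then exceed 1 and P^(m) can fail to be a transition kernel, so that its value function is undefined. For γ ≥ 1/5 nothing is added. *)

theory Defs
  imports "HOL-Analysis.Analysis" "HOL-Probability.Probability"
begin

(* A transition kernel P has entries P(s'|s,a) = P $ s $ a $ s', a policy p has entries
   p(a|s) = p $ s $ a.  Both live in Euclidean spaces whose inner product is the sum of the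
   products of all entries. *)

type_synonym ('s, 'a) kernel = "real^'s^'a^'s"
type_synonym ('s, 'a) policy = "real^'a^'s"

definition prob_simplex :: "(real^'n) set" where
  "prob_simplex = {p. (\<forall>i. 0 \<le> p $ i) \<and> (\<Sum>i\<in>UNIV. p $ i) = 1}"

definition kernels :: "('s::finite, 'a::finite) kernel set" where
  "kernels = {P. \<forall>s a. P $ s $ a \<in> prob_simplex}"

definition policies :: "('s::finite, 'a::finite) policy set" where
  "policies = {\<pi>. \<forall>s. \<pi> $ s \<in> prob_simplex}"

(* Meaningful for p in the simplex only. *)
definition simplex_pmf :: "real^'n \<Rightarrow> 'n pmf" where
  "simplex_pmf p = embed_pmf (\<lambda>i. p $ i)"

(* Conditional law of (S_i, A_i) given the pairs (S_j, A_j) = omega j with j < i, for S_0 = s0. *)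
definition step_law ::
  "('s::finite, 'a::finite) kernel \<Rightarrow> ('s, 'a) policy \<Rightarrow> 's \<Rightarrow> nat \<Rightarrow> (nat \<Rightarrow> 's \<times> 'a)
    \<Rightarrow> ('s \<times> 'a) measure" where
  "step_law P \<pi> s\<^sub>0 i \<omega> = measure_pmf
     (bind_pmf
       (case i of 0 \<Rightarrow> return_pmf s\<^sub>0
                | Suc j \<Rightarrow> simplex_pmf (P $ fst (\<omega> j) $ snd (\<omega> j)))
       (\<lambda>s. map_pmf (Pair s) (simplex_pmf (\<pi> $ s))))"

lemma Ionescu_Tulcea_step_law:
  fixes P :: "('s::finite, 'a::finite) kernel"
  shows "Ionescu_Tulcea (step_law P \<pi> s\<^sub>0) (\<lambda>_. count_space UNIV)"
proof (rule Ionescu_Tulcea.intro)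
  fix i :: nat
  show "step_law P \<pi> s\<^sub>0 i \<in> measurable (PiM {0..<i} (\<lambda>_. count_space UNIV))
      (subprob_algebra (count_space UNIV))"
  proof (cases i)
    case 0
    have "step_law P \<pi> s\<^sub>0 0 = (\<lambda>_. step_law P \<pi> s\<^sub>0 0 undefined)"
      by (simp add: step_law_def fun_eq_iff)
    moreover have "step_law P \<pi> s\<^sub>0 0 undefined \<in> space (subprob_algebra (count_space UNIV))"
      by (simp add: step_law_def measure_pmf_in_subprob_algebra)
    ultimately show ?thesis
      using 0 by (metis measurable_const)
  next
    case (Suc j)
    define K where "K = (\<lambda>x. measure_pmf
      (bind_pmf (simplex_pmf (P $ fst x $ snd x)) (\<lambda>s. map_pmf (Pair s) (simplex_pmf (\<pi> $ s)))))"
    have "K \<in> measurable (count_space UNIV) (subprob_algebra (count_space UNIV))"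
      by (simp add: K_def measure_pmf_in_subprob_algebra)
    moreover have "(\<lambda>\<omega>. \<omega> j) \<in> measurable (PiM {0..<i} (\<lambda>_. count_space UNIV)) (count_space UNIV)"
      using Suc by (intro measurable_component_singleton) simp
    ultimately have "(\<lambda>\<omega>. K (\<omega> j)) \<in> measurable (PiM {0..<i} (\<lambda>_. count_space UNIV))
        (subprob_algebra (count_space UNIV))"
      by (rule measurable_compose[rotated])
    moreover have "step_law P \<pi> s\<^sub>0 i = (\<lambda>\<omega>. K (\<omega> j))"
      by (simp add: step_law_def K_def Suc fun_eq_iff)
    ultimately show ?thesis by simp
  qed
next
  fix i :: nat and x :: "nat \<Rightarrow> 's \<times> 'a"
  show "prob_space (step_law P \<pi> s\<^sub>0 i x)"
    by (simp add: step_law_def prob_space_measure_pmf)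
qed

(* The law of the process (S_t, A_t), t = 0, 1, 2, ..., started at S_0 = s0, on the sequence
   space with the product sigma-algebra (the limit measure in the Ionescu-Tulcea theorem). *)
definition trajectory_law ::
  "('s::finite, 'a::finite) kernel \<Rightarrow> ('s, 'a) policy \<Rightarrow> 's \<Rightarrow> (nat \<Rightarrow> 's \<times> 'a) measure" where
  "trajectory_law P \<pi> s\<^sub>0 =
     projective_family.lim UNIV (Ionescu_Tulcea.CI (step_law P \<pi> s\<^sub>0) (\<lambda>_. count_space UNIV))
       (\<lambda>_. count_space UNIV)"

definition state_prob ::
  "('s::finite, 'a::finite) kernel \<Rightarrow> ('s, 'a) policy \<Rightarrow> 's \<Rightarrow> nat \<Rightarrow> 's \<Rightarrow> real" where
  "state_prob P \<pi> s\<^sub>0 t s = measure (trajectory_law P \<pi> s\<^sub>0)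
     {\<omega> \<in> space (trajectory_law P \<pi> s\<^sub>0). fst (\<omega> t) = s}"

definition irreducible_chain ::
  "('s::finite, 'a::finite) kernel \<Rightarrow> ('s, 'a) policy \<Rightarrow> bool" where
  "irreducible_chain P \<pi> \<longleftrightarrow> (\<forall>s s'. \<exists>t. state_prob P \<pi> s t s' > 0)"

definition value_fun ::
  "real \<Rightarrow> ('s::finite \<Rightarrow> 'a::finite \<Rightarrow> real) \<Rightarrow> ('s, 'a) policy \<Rightarrow> 's \<Rightarrow> ('s, 'a) kernel \<Rightarrow> real"
  where
  "value_fun \<gamma> c \<pi> s P =
     (LINT \<omega>|trajectory_law P \<pi> s. (\<Sum>t. \<gamma> ^ t * c (fst (\<omega> t)) (snd (\<omega> t))))"

definition worst_case_value ::
  "real \<Rightarrow> ('s::finite \<Rightarrow> 'a::finite \<Rightarrow> real) \<Rightarrow> ('s, 'a) policy \<Rightarrow> 's \<Rightarrow> ('s, 'a) kernel set \<Rightarrow> real"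
  where
  "worst_case_value \<gamma> c \<pi> s U = (SUP P\<in>U. value_fun \<gamma> c \<pi> s P)"

definition transition_matrix ::
  "('s::finite, 'a::finite) kernel \<Rightarrow> ('s, 'a) policy \<Rightarrow> real^'s^'s" where
  "transition_matrix P \<pi> = (\<chi> s s'. \<Sum>a\<in>UNIV. P $ s $ a $ s' * \<pi> $ s $ a)"

(* The rational function of P that agrees with value_fun on the kernels and is defined in a
   neighbourhood of them.  Derivatives with respect to P are those of this function: the set of
   kernels has empty interior. *)
definition value_ext ::
  "real \<Rightarrow> ('s::finite \<Rightarrow> 'a::finite \<Rightarrow> real) \<Rightarrow> ('s, 'a) policy \<Rightarrow> 's \<Rightarrow> ('s, 'a) kernel \<Rightarrow> real"
  where
  "value_ext \<gamma> c \<pi> s P =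
     (matrix_inv (mat 1 - \<gamma> *\<^sub>R transition_matrix P \<pi>) *v (\<chi> s. \<Sum>a\<in>UNIV. \<pi> $ s $ a * c s a)) $ s"

definition gradient :: "('v::real_inner \<Rightarrow> real) \<Rightarrow> 'v \<Rightarrow> 'v" where
  "gradient f x = (THE D. GDERIV f x :> D)"

definition value_grad ::
  "real \<Rightarrow> ('s::finite \<Rightarrow> 'a::finite \<Rightarrow> real) \<Rightarrow> ('s, 'a) policy \<Rightarrow> 's \<Rightarrow> ('s, 'a) kernel \<Rightarrow> ('s, 'a) kernel"
  where
  "value_grad \<gamma> c \<pi> s P = gradient (value_ext \<gamma> c \<pi> s) P"

definition s_rectangular :: "('s::finite, 'a::finite) kernel set \<Rightarrow> bool" where
  "s_rectangular U \<longleftrightarrow>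
     (\<exists>V :: 's \<Rightarrow> (real^'s^'a) set.
        (\<forall>s. V s \<subseteq> {p. \<forall>a. p $ a \<in> prob_simplex}) \<and> U = {P. \<forall>s. P $ s \<in> V s})"

(* s-rectangularity is closed under intersection, so the hull is the smallest s-rectangular
   superset. *)
definition s_rect_hull :: "('s::finite, 'a::finite) kernel set \<Rightarrow> ('s, 'a) kernel set" where
  "s_rect_hull U = s_rectangular hull U"

definition visitation ::
  "real \<Rightarrow> ('s::finite, 'a::finite) policy \<Rightarrow> 's \<Rightarrow> ('s, 'a) kernel \<Rightarrow> 's \<Rightarrow> real" where
  "visitation \<gamma> \<pi> s\<^sub>0 P s = (1 - \<gamma>) * (\<Sum>t. \<gamma> ^ t * state_prob P \<pi> s\<^sub>0 t s)"

definition mismatch_coeff ::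
  "real \<Rightarrow> ('s::finite, 'a::finite) policy \<Rightarrow> 's \<Rightarrow> ('s, 'a) kernel set \<Rightarrow> real" where
  "mismatch_coeff \<gamma> \<pi> s\<^sub>0 U =
     (SUP (P, P') \<in> s_rect_hull U \<times> s_rect_hull U.
        MAX s\<in>UNIV. visitation \<gamma> \<pi> s\<^sub>0 P' s / visitation \<gamma> \<pi> s\<^sub>0 P s)"

definition nonrect_at ::
  "real \<Rightarrow> ('s::finite \<Rightarrow> 'a::finite \<Rightarrow> real) \<Rightarrow> ('s, 'a) policy \<Rightarrow> 's \<Rightarrow> ('s, 'a) kernel set
    \<Rightarrow> ('s, 'a) kernel \<Rightarrow> real" where
  "nonrect_at \<gamma> c \<pi> s\<^sub>0 U P' =
     (SUP P\<in>s_rect_hull U. value_grad \<gamma> c \<pi> s\<^sub>0 P' \<bullet> P) - (SUP P\<in>U. value_grad \<gamma> c \<pi> s\<^sub>0 P' \<bullet> P)"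

definition nonrect_degree ::
  "real \<Rightarrow> ('s::finite \<Rightarrow> 'a::finite \<Rightarrow> real) \<Rightarrow> ('s, 'a) policy \<Rightarrow> 's \<Rightarrow> ('s, 'a) kernel set \<Rightarrow> real"
  where
  "nonrect_degree \<gamma> c \<pi> s\<^sub>0 U = (SUP P'\<in>U. nonrect_at \<gamma> c \<pi> s\<^sub>0 U P')"

definition affine_map_on :: "'v::real_vector set \<Rightarrow> ('v \<Rightarrow> 'w::real_vector) \<Rightarrow> bool" where
  "affine_map_on X f \<longleftrightarrow> (\<exists>L b. linear L \<and> (\<forall>x\<in>X. f x = L x + b))"

(* Objective of the direction-finding subproblem at P, evaluated at Q. *)
definition fw_objective ::
  "real \<Rightarrow> ('s::finite \<Rightarrow> 'a::finite \<Rightarrow> real) \<Rightarrow> ('s, 'a) policy \<Rightarrow> 's \<Rightarrow> ('s, 'a) kernel \<Rightarrow> ('s, 'a) kernel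
    \<Rightarrow> real" where
  "fw_objective \<gamma> c \<pi> s\<^sub>0 P Q = value_grad \<gamma> c \<pi> s\<^sub>0 P \<bullet> (Q - P)"

definition eps_optimal_direction ::
  "real \<Rightarrow> ('s::finite \<Rightarrow> 'a::finite \<Rightarrow> real) \<Rightarrow> ('s, 'a) policy \<Rightarrow> 's \<Rightarrow> ('s, 'a) kernel set \<Rightarrow> real
    \<Rightarrow> ('s, 'a) kernel \<Rightarrow> ('s, 'a) kernel \<Rightarrow> bool" where
  "eps_optimal_direction \<gamma> c \<pi> s\<^sub>0 U \<epsilon> P Q \<longleftrightarrow>
     Q \<in> U \<and> fw_objective \<gamma> c \<pi> s\<^sub>0 P Q \<ge> (SUP Q'\<in>U. fw_objective \<gamma> c \<pi> s\<^sub>0 P Q') - \<epsilon>"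

(* A run is a pair of sequences: Pit m is the iterate P^(m) and Peps m the approximate solution
   of the subproblem computed in iteration m.  Iteration m is reached if no earlier one
   terminates; entries of the sequences beyond the terminating iteration are unconstrained.
   The step sizes need no positivity condition here: the update is only made if the objective
   exceeds the tolerance, where the step size of the theorem is positive. *)

definition fw_reaches ::
  "real \<Rightarrow> ('s::finite \<Rightarrow> 'a::finite \<Rightarrow> real) \<Rightarrow> ('s, 'a) policy \<Rightarrow> 's \<Rightarrow> real
    \<Rightarrow> (nat \<Rightarrow> ('s, 'a) kernel) \<Rightarrow> (nat \<Rightarrow> ('s, 'a) kernel) \<Rightarrow> nat \<Rightarrow> bool" where
  "fw_reaches \<gamma> c \<pi> s\<^sub>0 \<epsilon> Pit Peps m \<longleftrightarrow> (\<forall>k<m. fw_objective \<gamma> c \<pi> s\<^sub>0 (Pit k) (Peps k) > \<epsilon>)"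

definition fw_run ::
  "real \<Rightarrow> ('s::finite \<Rightarrow> 'a::finite \<Rightarrow> real) \<Rightarrow> ('s, 'a) policy \<Rightarrow> 's \<Rightarrow> ('s, 'a) kernel set
    \<Rightarrow> (nat \<Rightarrow> real) \<Rightarrow> real \<Rightarrow> (nat \<Rightarrow> ('s, 'a) kernel) \<Rightarrow> (nat \<Rightarrow> ('s, 'a) kernel) \<Rightarrow> bool" where
  "fw_run \<gamma> c \<pi> s\<^sub>0 U \<alpha> \<epsilon> Pit Peps \<longleftrightarrow>
     Pit 0 \<in> U \<and>
     (\<forall>m. fw_reaches \<gamma> c \<pi> s\<^sub>0 \<epsilon> Pit Peps m \<longrightarrow>
        eps_optimal_direction \<gamma> c \<pi> s\<^sub>0 U \<epsilon> (Pit m) (Peps m) \<and>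
        (fw_objective \<gamma> c \<pi> s\<^sub>0 (Pit m) (Peps m) > \<epsilon> \<longrightarrow>
           Pit (Suc m) = (1 - \<alpha> m) *\<^sub>R Pit m + \<alpha> m *\<^sub>R Peps m))"

(* Iteration m (counted from 0, so after m updates) terminates; the output is Pit m. *)
definition fw_terminates_at ::
  "real \<Rightarrow> ('s::finite \<Rightarrow> 'a::finite \<Rightarrow> real) \<Rightarrow> ('s, 'a) policy \<Rightarrow> 's \<Rightarrow> real
    \<Rightarrow> (nat \<Rightarrow> ('s, 'a) kernel) \<Rightarrow> (nat \<Rightarrow> ('s, 'a) kernel) \<Rightarrow> nat \<Rightarrow> bool" where
  "fw_terminates_at \<gamma> c \<pi> s\<^sub>0 \<epsilon> Pit Peps m \<longleftrightarrow>
     fw_reaches \<gamma> c \<pi> s\<^sub>0 \<epsilon> Pit Peps m \<and> fw_objective \<gamma> c \<pi> s\<^sub>0 (Pit m) (Peps m) \<le> \<epsilon>"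

(* Every iterate P^(m) that the algorithm computes belongs to U, as is required for P^(m) to be a
   kernel with a value function.  The step size G_m (1 - gamma)^3 / (4 gamma^2) is at most
   (1 - gamma) / (4 gamma) as long as P^(m) is in U, so this is automatic for gamma >= 1/5 and U
   convex; for smaller gamma the step size can exceed 1 and the iterates can leave the set of
   kernels. *)
definition fw_feasible ::
  "real \<Rightarrow> ('s::finite \<Rightarrow> 'a::finite \<Rightarrow> real) \<Rightarrow> ('s, 'a) policy \<Rightarrow> 's \<Rightarrow> ('s, 'a) kernel set \<Rightarrow> real
    \<Rightarrow> (nat \<Rightarrow> ('s, 'a) kernel) \<Rightarrow> (nat \<Rightarrow> ('s, 'a) kernel) \<Rightarrow> bool" where
  "fw_feasible \<gamma> c \<pi> s\<^sub>0 U \<epsilon> Pit Peps \<longleftrightarrow>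
     (\<forall>m. fw_reaches \<gamma> c \<pi> s\<^sub>0 \<epsilon> Pit Peps m \<longrightarrow> Pit m \<in> U)"

end

theory Submission
  imports Defs
begin

text \<open>
  Write \<open>V\<^sup>P\<close> for the value of a kernel \<open>P\<close> and \<open>N\<^sup>P = (I - \<gamma> P\<^sub>\<pi>)\<^sup>-\<^sup>1\<close> for its
  resolvent.  Row \<open>s\<^sub>0\<close> of \<open>N\<^sup>P\<close> collects the discounted expected numbers of visits, so it equals
  \<open>d\<^sup>P / (1 - \<gamma>)\<close>, and \<open>V\<^sup>P = N\<^sup>P c\<^sub>\<pi>\<close>.  Everything rests on the resolvent identity
  \<open>N\<^sup>Q - N\<^sup>P = \<gamma> N\<^sup>Q (Q - P)\<^sub>\<pi> N\<^sup>P\<close>, which is used in three ways.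

  \<^item> Applied to \<open>c\<^sub>\<pi>\<close> it writes \<open>V\<^sup>Q - V\<^sup>P\<close> as the inner product of \<open>Q - P\<close> with a vector that
    depends continuously on \<open>Q\<close> and has the entries
    \<open>\<gamma> N\<^sup>Q(s\<^sub>0, s) \<pi>(a|s) V\<^sup>P(s')\<close>; hence its value at \<open>Q = P\<close> is the gradient
    (\<open>value_difference\<close>, \<open>value_grad_eq\<close>).

  \<^item> The block of that vector that belongs to a state \<open>s\<close> is the corresponding block of the gradient
    at \<open>P\<close>, multiplied by \<open>d\<^sup>Q(s) / d\<^sup>P(s)\<close> (\<open>performance_difference\<close>).  Blocks with a negative
    contribution can be replaced by those of \<open>P\<close> without leaving the rectangular hull, and the
    other factors are at most \<open>\<delta>\<^sub>d\<close>.  So \<open>V\<^sup>Q - V\<^sup>P\<close> is at most \<open>\<delta>\<^sub>d\<close> times the largest directional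
    derivative at \<open>P\<close> towards the rectangular hull (\<open>gradient_domination\<close>).  Passing from the hull
    to the uncertainty set costs the degree of non-rectangularity, and at the terminating iterate
    the derivatives towards the uncertainty set are at most \<open>2 \<epsilon>\<close>.

  \<^item> Applied a second time, with the bounds on \<open>N\<^sup>P\<close> that follow from the minimum principle, it shows
    that a step of length \<open>\<alpha>\<close> along a direction of slope \<open>G\<close> gains at least
    \<open>\<alpha> G - 2 \<gamma>\<^sup>2 \<alpha>\<^sup>2 / (1 - \<gamma>)\<^sup>3\<close> (\<open>ascent_lower_bound\<close>).  The prescribed stepsize
    maximises this, and the gain \<open>G\<^sup>2 (1 - \<gamma>)\<^sup>3 / (8 \<gamma>\<^sup>2)\<close> exceeds a fixed multiple of \<open>\<epsilon>\<^sup>2\<close> until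
    the termination test succeeds.  Values lie in \<open>[0, 1 / (1 - \<gamma>)]\<close>, so there are at most
    \<open>8 \<gamma>\<^sup>2 / ((1 - \<gamma>)\<^sup>4 \<epsilon>\<^sup>2)\<close> such steps (\<open>fw_iterations_bound\<close>).

  The quantities of the theorem are integrals and probabilities under the law of the whole
  trajectory.  They depend only on the laws of the single pairs \<open>(S\<^sub>t, A\<^sub>t)\<close>, which obey the
  recursion of a Markov chain (\<open>distr_trajectory_law\<close>) and sum up to the resolvent
  (\<open>discounted_state_sum\<close>).
\<close>

section \<open>Marginal laws of the trajectory\<close>

definition act_law :: "('s::finite, 'a::finite) policy \<Rightarrow> 's pmf \<Rightarrow> ('s \<times> 'a) pmf" where
  "act_law \<pi> p = bind_pmf p (\<lambda>s. map_pmf (Pair s) (simplex_pmf (\<pi> $ s)))"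

primrec marginal_law ::
  "('s::finite, 'a::finite) kernel \<Rightarrow> ('s, 'a) policy \<Rightarrow> 's \<Rightarrow> nat \<Rightarrow> ('s \<times> 'a) pmf" where
  "marginal_law P \<pi> s\<^sub>0 0 = act_law \<pi> (return_pmf s\<^sub>0)"
| "marginal_law P \<pi> s\<^sub>0 (Suc t) =
     bind_pmf (marginal_law P \<pi> s\<^sub>0 t) (\<lambda>x. act_law \<pi> (simplex_pmf (P $ fst x $ snd x)))"

lemma step_law_0: "step_law P \<pi> s\<^sub>0 0 \<omega> = measure_pmf (marginal_law P \<pi> s\<^sub>0 0)"
  by (simp add: step_law_def act_law_def)

lemma step_law_Suc:
  "step_law P \<pi> s\<^sub>0 (Suc j) \<omega> = measure_pmf (act_law \<pi> (simplex_pmf (P $ fst (\<omega> j) $ snd (\<omega> j))))"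
  by (simp add: step_law_def act_law_def)

lemma sets_trajectory_law:
  "sets (trajectory_law P \<pi> s\<^sub>0) = sets (PiM UNIV (\<lambda>_. count_space UNIV))"
proof -
  interpret IT: Ionescu_Tulcea "step_law P \<pi> s\<^sub>0" "\<lambda>_. count_space UNIV"
    by (rule Ionescu_Tulcea_step_law)
  show ?thesis by (simp add: trajectory_law_def)
qed

lemma space_trajectory_law [simp]: "space (trajectory_law P \<pi> s\<^sub>0) = UNIV"
  using sets_eq_imp_space_eq[OF sets_trajectory_law] by (simp add: space_PiM)

lemma measurable_coordinate [measurable]:
  "(\<lambda>\<omega>. \<omega> t) \<in> measurable (trajectory_law P \<pi> s\<^sub>0) (count_space UNIV)"
  unfolding measurable_cong_sets[OF sets_trajectory_law refl]
  by (rule measurable_component_singleton) simp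

text \<open>
  The one-step kernels depend on the history only through its last entry.  Hence the law of the
  \<open>t\<close>-th coordinate, which is the law of the history up to \<open>t - 1\<close> followed by one step, is
  determined by the law of the preceding coordinate alone.  The trajectory law has the finite
  products of the construction as its projections, so its coordinates have the same laws.
\<close>
lemma distr_trajectory_law:
  "distr (trajectory_law P \<pi> s\<^sub>0) (count_space UNIV) (\<lambda>\<omega>. \<omega> t) = measure_pmf (marginal_law P \<pi> s\<^sub>0 t)"
proof -
  interpret IT: Ionescu_Tulcea "step_law P \<pi> s\<^sub>0" "\<lambda>_. count_space UNIV"
    by (rule Ionescu_Tulcea_step_law)
  let ?M = "\<lambda>n. PiM {0..<n} (\<lambda>_. count_space (UNIV :: ('a \<times> 'b) set))"
  define u :: "nat \<Rightarrow> 'a \<times> 'b" where "u = (\<lambda>_. undefined)"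
  have u: "u \<in> space (?M 0)" by (simp add: u_def space_PiM)
  have sC: "sets (IT.C 0 n u) = sets (?M n)" for n
    using IT.sets_C[OF u, of n] by simp
  have spC: "space (IT.C 0 n u) = space (?M n)" for n
    using IT.space_C[OF u, of n] by simp
  have ne: "space (?M n) \<noteq> {}" for n :: nat
    by (simp add: space_PiM PiE_eq_empty_iff)
  have coord: "(\<lambda>\<omega>. \<omega> j) \<in> measurable (?M n) (count_space UNIV)" if "j < n" for j n :: nat
    using that by (intro measurable_component_singleton) simp
  \<comment> \<open>\<open>IT.C 0 n u\<close> is the joint law of the coordinates below \<open>n\<close>.\<close>
  have last: "distr (IT.C 0 (Suc n) u) (count_space UNIV) (\<lambda>\<omega>. \<omega> n) =
      (IT.C 0 n u \<bind> step_law P \<pi> s\<^sub>0 n)" for n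
  proof -
    have eP: "IT.eP n \<in> measurable (IT.C 0 n u) (subprob_algebra (?M (Suc n)))"
      unfolding measurable_cong_sets[OF sC refl] by (rule IT.measurable_eP)
    have "distr (IT.C 0 n u \<bind> IT.eP n) (count_space UNIV) (\<lambda>\<omega>. \<omega> n) =
        (IT.C 0 n u \<bind> (\<lambda>\<omega>. distr (IT.eP n \<omega>) (count_space UNIV) (\<lambda>\<omega>. \<omega> n)))"
      by (rule distr_bind[OF eP]) (auto simp: spC ne intro: coord)
    also have "\<dots> = (IT.C 0 n u \<bind> step_law P \<pi> s\<^sub>0 n)"
    proof (rule bind_cong[OF refl])
      fix \<omega> assume "\<omega> \<in> space (IT.C 0 n u)"
      then have \<omega>: "\<omega> \<in> space (?M n)" by (simp add: spC)
      have sP: "sets (step_law P \<pi> s\<^sub>0 n \<omega>) = sets (count_space UNIV)"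
        by (rule IT.sets_P[OF \<omega>])
      have "fun_upd \<omega> n \<in> measurable (step_law P \<pi> s\<^sub>0 n \<omega>) (?M (Suc n))"
        unfolding measurable_cong_sets[OF sP refl]
        using \<omega> by (auto simp: space_PiM PiE_iff extensional_def)
      then have "distr (IT.eP n \<omega>) (count_space UNIV) (\<lambda>\<omega>. \<omega> n) =
          distr (step_law P \<pi> s\<^sub>0 n \<omega>) (count_space UNIV) ((\<lambda>\<omega>. \<omega> n) \<circ> fun_upd \<omega> n)"
        unfolding IT.eP_def by (intro distr_distr coord) auto
      also have "\<dots> = step_law P \<pi> s\<^sub>0 n \<omega>"
        using sP by (simp add: comp_def distr_id2)
      finally show "distr (IT.eP n \<omega>) (count_space UNIV) (\<lambda>\<omega>. \<omega> n) = step_law P \<pi> s\<^sub>0 n \<omega>" .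
    qed
    finally show ?thesis by simp
  qed
  have marginal: "distr (IT.C 0 (Suc n) u) (count_space UNIV) (\<lambda>\<omega>. \<omega> n) =
      measure_pmf (marginal_law P \<pi> s\<^sub>0 n)" for n
  proof (induction n)
    case 0
    interpret C0: prob_space "IT.C 0 0 u" using IT.prob_space_C[OF u, of 0] .
    have "(IT.C 0 0 u \<bind> step_law P \<pi> s\<^sub>0 0) =
        (IT.C 0 0 u \<bind> (\<lambda>_. measure_pmf (marginal_law P \<pi> s\<^sub>0 0)))"
      by (simp only: step_law_0[abs_def])
    also have "\<dots> = measure_pmf (marginal_law P \<pi> s\<^sub>0 0)"
      by (rule bind_const') (use C0.prob_space_axioms prob_space_imp_subprob_space prob_space_measure_pmf in blast)+
    finally show ?case by (simp only: last)
  next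
    case (Suc n)
    let ?K = "\<lambda>x. measure_pmf (act_law \<pi> (simplex_pmf (P $ fst x $ snd x)))"
    have "distr (IT.C 0 (Suc (Suc n)) u) (count_space UNIV) (\<lambda>\<omega>. \<omega> (Suc n)) =
        (IT.C 0 (Suc n) u \<bind> (\<lambda>\<omega>. ?K (\<omega> n)))"
      by (simp only: last step_law_Suc[abs_def])
    also have "\<dots> = (distr (IT.C 0 (Suc n) u) (count_space UNIV) (\<lambda>\<omega>. \<omega> n) \<bind> ?K)"
    proof (rule bind_distr[symmetric])
      show "(\<lambda>\<omega>. \<omega> n) \<in> measurable (IT.C 0 (Suc n) u) (count_space UNIV)"
        unfolding measurable_cong_sets[OF sC refl] by (rule coord) simp
      show "?K \<in> measurable (count_space UNIV) (subprob_algebra (count_space UNIV))"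
        by (simp add: measure_pmf_in_subprob_algebra)
      show "space (IT.C 0 (Suc n) u) \<noteq> {}" by (simp only: spC ne not_False_eq_True)
    qed
    also have "\<dots> = measure_pmf (marginal_law P \<pi> s\<^sub>0 (Suc n))"
      by (simp only: Suc.IH marginal_law.simps measure_pmf_bind)
    finally show ?case .
  qed
  have up: "IT.up_to {0..<n} = n" for n
  proof (rule antisym)
    show "IT.up_to {0..<n} \<le> n" by (subst IT.up_to_iff_Ico) auto
    show "n \<le> IT.up_to {0..<n}" using IT.up_to[of "{0..<n}"] by (simp add: subset_iff) (meson less_irrefl not_le)
  qed
  have CI: "IT.CI {0..<n} = IT.C 0 n u" for n
    unfolding IT.CI_def up using IT.distr_C[of n n "u" 0] u by (simp add: u_def)
  let ?J = "{0..<Suc t}"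
  have "distr (trajectory_law P \<pi> s\<^sub>0) (count_space UNIV) (\<lambda>\<omega>. \<omega> t) =
      distr (trajectory_law P \<pi> s\<^sub>0) (count_space UNIV) ((\<lambda>\<omega>. \<omega> t) \<circ> (\<lambda>\<omega>. restrict \<omega> ?J))"
    by (simp add: comp_def)
  also have "\<dots> = distr (distr (trajectory_law P \<pi> s\<^sub>0) (?M (Suc t)) (\<lambda>\<omega>. restrict \<omega> ?J))
      (count_space UNIV) (\<lambda>\<omega>. \<omega> t)"
    by (rule distr_distr[symmetric])
      (auto intro!: coord measurable_restrict_subset simp: measurable_cong_sets[OF sets_trajectory_law refl])
  also have "\<dots> = distr (IT.CI ?J) (count_space UNIV) (\<lambda>\<omega>. \<omega> t)"
    unfolding trajectory_law_def by (subst IT.distr_lim) auto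
  finally show ?thesis by (simp only: CI marginal)
qed

lemma pmf_simplex_pmf: "p \<in> prob_simplex \<Longrightarrow> pmf (simplex_pmf p) i = p $ i"
  unfolding simplex_pmf_def prob_simplex_def
  by (subst pmf_embed_pmf) (auto simp: nn_integral_count_space_finite simp flip: ennreal_1)

section \<open>The resolvent of the discounted chain\<close>

definition bellman_matrix :: "real \<Rightarrow> ('s::finite, 'a::finite) policy \<Rightarrow> ('s, 'a) kernel \<Rightarrow> real^'s^'s" where
  "bellman_matrix \<gamma> \<pi> P = mat 1 - \<gamma> *\<^sub>R transition_matrix P \<pi>"

definition resolvent :: "real \<Rightarrow> ('s::finite, 'a::finite) policy \<Rightarrow> ('s, 'a) kernel \<Rightarrow> real^'s^'s" where
  "resolvent \<gamma> \<pi> P = matrix_inv (bellman_matrix \<gamma> \<pi> P)"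

definition stage_cost :: "('s::finite \<Rightarrow> 'a::finite \<Rightarrow> real) \<Rightarrow> ('s, 'a) policy \<Rightarrow> real^'s" where
  "stage_cost c \<pi> = (\<chi> s. \<Sum>a\<in>UNIV. \<pi> $ s $ a * c s a)"

definition value_vec ::
  "real \<Rightarrow> ('s::finite \<Rightarrow> 'a::finite \<Rightarrow> real) \<Rightarrow> ('s, 'a) policy \<Rightarrow> ('s, 'a) kernel \<Rightarrow> real^'s" where
  "value_vec \<gamma> c \<pi> P = resolvent \<gamma> \<pi> P *v stage_cost c \<pi>"

lemma value_ext_eq: "value_ext \<gamma> c \<pi> s P = value_vec \<gamma> c \<pi> P $ s"
  by (simp add: value_ext_def value_vec_def resolvent_def bellman_matrix_def stage_cost_def)

lemma bellman_matrix_nth: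
  "(bellman_matrix \<gamma> \<pi> P *v x) $ s = x $ s - \<gamma> * (transition_matrix P \<pi> *v x) $ s"
  by (simp add: bellman_matrix_def matrix_vector_mult_diff_rdistrib scaleR_matrix_vector_assoc[symmetric])

lemma transition_matrix_diff:
  "transition_matrix (P - Q) \<pi> = transition_matrix P \<pi> - transition_matrix Q \<pi>"
  by (simp add: transition_matrix_def vec_eq_iff sum_subtractf left_diff_distrib)

lemma transition_matrix_scaleR:
  "transition_matrix (r *\<^sub>R P) \<pi> = r *\<^sub>R transition_matrix P \<pi>"
  by (simp add: transition_matrix_def vec_eq_iff sum_distrib_left mult.assoc)

lemma transition_matrix_simplex:
  assumes "P \<in> kernels" "\<pi> \<in> policies"
  shows "transition_matrix P \<pi> $ s \<in> prob_simplex"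
proof -
  have P: "0 \<le> P $ s $ a $ s'" "(\<Sum>s'\<in>UNIV. P $ s $ a $ s') = 1" for a s'
    using assms by (auto simp: kernels_def prob_simplex_def)
  have p: "0 \<le> \<pi> $ s $ a" "(\<Sum>a\<in>UNIV. \<pi> $ s $ a) = 1" for a
    using assms by (auto simp: policies_def prob_simplex_def)
  have "(\<Sum>s'\<in>UNIV. \<Sum>a\<in>UNIV. P $ s $ a $ s' * \<pi> $ s $ a) = 1"
    by (subst sum.swap) (simp add: sum_distrib_right[symmetric] P p)
  then show ?thesis
    using P p by (auto simp: prob_simplex_def transition_matrix_def intro!: sum_nonneg)
qed

lemma simplex_average_ge:
  fixes T :: "real^'n^'m"
  assumes "T $ s \<in> prob_simplex" "\<And>j. lo \<le> x $ j"
  shows "lo \<le> (T *v x) $ s"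
proof -
  have "lo = (\<Sum>j\<in>UNIV. T $ s $ j * lo)"
    using assms(1) by (simp add: prob_simplex_def sum_distrib_right[symmetric])
  also have "\<dots> \<le> (\<Sum>j\<in>UNIV. T $ s $ j * x $ j)"
    using assms by (intro sum_mono mult_left_mono) (auto simp: prob_simplex_def)
  finally show ?thesis by (simp add: matrix_vector_mult_def)
qed

lemma matrix_vector_mult_uminus: "(A :: real^'n^'m) *v (- x) = - (A *v x)"
  using matrix_vector_mult_diff_distrib[of A 0 x] by simp

lemma simplex_average_le:
  fixes T :: "real^'n^'m"
  assumes "T $ s \<in> prob_simplex" "\<And>j. x $ j \<le> hi"
  shows "(T *v x) $ s \<le> hi"
  using simplex_average_ge[OF assms(1), of "- hi" "- x"] assms(2)
  by (simp add: matrix_vector_mult_uminus)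

text \<open>
  At an index where \<open>x\<close> is minimal, averaging with respect to the transition probabilities cannot
  decrease its value, so \<open>x i \<ge> \<gamma> x i\<close> there.
  This gives invertibility, positivity and the sup-norm bounds of the resolvent at once.
\<close>
lemma bellman_minimum_principle:
  assumes "0 < \<gamma>" "\<gamma> < 1" "P \<in> kernels" "\<pi> \<in> policies"
    and "\<And>s. 0 \<le> (bellman_matrix \<gamma> \<pi> P *v x) $ s"
  shows "0 \<le> x $ s"
proof -
  obtain i where i: "\<And>j. x $ i \<le> x $ j"
    using ex_is_arg_min_if_finite[of UNIV "($) x"] by (auto simp: is_arg_min_linorder)
  have "\<gamma> * x $ i \<le> \<gamma> * (transition_matrix P \<pi> *v x) $ i"
    using assms by (intro mult_left_mono simplex_average_ge transition_matrix_simplex i) auto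
  also have "\<dots> \<le> x $ i"
    using assms(5)[of i] by (simp add: bellman_matrix_nth)
  finally have "0 \<le> (1 - \<gamma>) * x $ i" by (simp add: algebra_simps)
  then have "0 \<le> x $ i" using assms(2) by (simp add: zero_le_mult_iff)
  with i show ?thesis by (rule order_trans[rotated])
qed

locale discounted_policy =
  fixes \<gamma> :: real and \<pi> :: "('s::finite, 'a::finite) policy"
  assumes discount: "0 < \<gamma>" "\<gamma> < 1" and policy: "\<pi> \<in> policies"
begin

lemma bellman_upper_bound:
  assumes "P \<in> kernels" "\<And>s. (bellman_matrix \<gamma> \<pi> P *v x) $ s \<le> b"
  shows "x $ s \<le> b / (1 - \<gamma>)"
proof -
  define r where "r = b / (1 - \<gamma>)"
  \<comment> \<open>The constant vector \<open>r\<close> solves the equation with right-hand side \<open>b\<close>; compare \<open>x\<close> with it.\<close>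
  define y where "y = (\<chi> j. r) - x"
  have r: "(1 - \<gamma>) * r = b" using discount by (simp add: r_def)
  have c: "(transition_matrix P \<pi> *v (\<chi> j. r)) $ s = r" for s
    using transition_matrix_simplex[OF assms(1) policy, of s]
    by (intro antisym simplex_average_le simplex_average_ge) auto
  have "0 \<le> y $ s"
  proof (rule bellman_minimum_principle[OF discount assms(1) policy])
    fix s
    have "(bellman_matrix \<gamma> \<pi> P *v y) $ s = b - (bellman_matrix \<gamma> \<pi> P *v x) $ s"
      unfolding bellman_matrix_nth using r c[of s]
      by (simp add: y_def matrix_vector_mult_diff_distrib algebra_simps)
    then show "0 \<le> (bellman_matrix \<gamma> \<pi> P *v y) $ s" using assms(2)[of s] by simp
  qed
  then show ?thesis by (simp add: y_def r_def)
qed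

lemma bellman_abs_bound:
  assumes "P \<in> kernels" "\<And>s. \<bar>(bellman_matrix \<gamma> \<pi> P *v x) $ s\<bar> \<le> b"
  shows "\<bar>x $ s\<bar> \<le> b / (1 - \<gamma>)"
proof -
  have "(bellman_matrix \<gamma> \<pi> P *v x) $ s \<le> b" "(bellman_matrix \<gamma> \<pi> P *v (- x)) $ s \<le> b" for s
    using assms(2)[of s] by (simp_all only: abs_le_iff matrix_vector_mult_uminus vector_uminus_component)
  note b = this
  have "x $ s \<le> b / (1 - \<gamma>)" "(- x) $ s \<le> b / (1 - \<gamma>)"
    by (rule bellman_upper_bound[OF assms(1)], rule b)+
  then show ?thesis by (simp add: abs_le_iff)
qed

lemma invertible_bellman:
  assumes "P \<in> kernels"
  shows "invertible (bellman_matrix \<gamma> \<pi> P)"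
  unfolding invertible_left_inverse matrix_left_invertible_ker
proof (intro allI impI)
  fix x assume "bellman_matrix \<gamma> \<pi> P *v x = 0"
  then have "\<bar>x $ s\<bar> \<le> 0 / (1 - \<gamma>)" for s
    by (intro bellman_abs_bound[OF assms]) simp
  then show "x = 0" by (simp add: vec_eq_iff)
qed

end

lemma matrix_inv_mult:
  fixes A :: "real^'n^'n"
  assumes "invertible A"
  shows "A ** matrix_inv A = mat 1" "matrix_inv A ** A = mat 1"
  using someI_ex[OF assms[unfolded invertible_def]] by (auto simp: matrix_inv_def)

lemma bellman_resolvent:
  assumes "invertible (bellman_matrix \<gamma> \<pi> P)"
  shows "bellman_matrix \<gamma> \<pi> P *v (resolvent \<gamma> \<pi> P *v x) = x"
    and "resolvent \<gamma> \<pi> P *v (bellman_matrix \<gamma> \<pi> P *v x) = x"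
  by (simp_all add: resolvent_def matrix_vector_mul_assoc matrix_inv_mult[OF assms])

lemma isCont_det:
  fixes A :: "'b::t2_space \<Rightarrow> real^'n^'n"
  assumes "\<And>i j. isCont (\<lambda>y. A y $ i $ j) x"
  shows "isCont (\<lambda>y. det (A y)) x"
  unfolding det_def by (intro continuous_intros assms)

lemma eventually_invertible:
  fixes A :: "'b::t2_space \<Rightarrow> real^'n^'n"
  assumes cont: "\<And>i j. isCont (\<lambda>y. A y $ i $ j) x" and inv: "invertible (A x)"
  shows "\<forall>\<^sub>F y in nhds x. invertible (A y)"
proof -
  have nz: "det (A x) \<noteq> 0" using inv by (simp add: invertible_det_nz)
  with isCont_det[OF cont] have "\<forall>\<^sub>F y in at x. det (A y) \<noteq> 0"
    unfolding isCont_def by (rule tendsto_imp_eventually_ne)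
  with nz show ?thesis by (simp add: eventually_nhds_conv_at invertible_det_nz)
qed

text \<open>
  By Cramer's rule each entry is, near \<open>x\<close>, a quotient of two determinants.
\<close>
lemma isCont_matrix_inv_mult:
  fixes A :: "'b::t2_space \<Rightarrow> real^'n^'n"
  assumes cont: "\<And>i j. isCont (\<lambda>y. A y $ i $ j) x" and inv: "invertible (A x)"
  shows "isCont (\<lambda>y. (matrix_inv (A y) *v b) $ k) x"
proof -
  define B where "B y = (\<chi> i j. if j = k then b $ i else A y $ i $ j)" for y
  have nz: "det (A x) \<noteq> 0" using inv by (simp add: invertible_det_nz)
  have ev: "\<forall>\<^sub>F y in nhds x. (matrix_inv (A y) *v b) $ k = det (B y) / det (A y)"
    using eventually_invertible[OF cont inv]
  proof eventually_elim
    case (elim y)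
    then have sol: "A y *v (matrix_inv (A y) *v b) = b"
      by (simp add: matrix_vector_mul_assoc matrix_inv_mult)
    have "det (A y) \<noteq> 0" using elim by (simp add: invertible_det_nz)
    from arg_cong[OF cramer[OF this, THEN iffD1, OF sol], of "\<lambda>v. v $ k"]
    show ?case by (simp only: vec_lambda_beta B_def)
  qed
  have "isCont (\<lambda>y. B y $ i $ j) x" for i j
    using cont by (cases "j = k") (simp_all add: B_def)
  then have "isCont (\<lambda>y. det (B y) / det (A y)) x"
    using nz by (intro isCont_divide isCont_det cont) auto
  then show ?thesis unfolding isCont_cong[OF ev] .
qed

section \<open>Visitation frequencies and values in terms of the resolvent\<close>

lemma pmf_act_law:
  assumes "\<pi> \<in> policies"
  shows "pmf (act_law \<pi> p) (s, a) = pmf p s * \<pi> $ s $ a"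
proof -
  have row: "\<pi> $ s' \<in> prob_simplex" for s' using assms by (simp add: policies_def)
  have "pmf (map_pmf (Pair s') (simplex_pmf (\<pi> $ s'))) (s, a) = (if s' = s then \<pi> $ s $ a else 0)" for s'
    using pmf_map_inj'[of "Pair s'" "simplex_pmf (\<pi> $ s')" a]
    by (auto simp: pmf_simplex_pmf[OF row] inj_on_def pmf_eq_0_set_pmf)
  then show ?thesis
    by (simp add: act_law_def pmf_bind integral_measure_pmf_real[of UNIV]
        if_distrib[of "\<lambda>x. x * y" for y] cong: if_cong)
qed

lemma state_prob_eq_sum: "state_prob P \<pi> s\<^sub>0 t s = (\<Sum>a\<in>UNIV. pmf (marginal_law P \<pi> s\<^sub>0 t) (s, a))"
proof -
  let ?A = "{x :: 'a \<times> 'b. fst x = s}"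
  have "state_prob P \<pi> s\<^sub>0 t s =
      measure (distr (trajectory_law P \<pi> s\<^sub>0) (count_space UNIV) (\<lambda>\<omega>. \<omega> t)) ?A"
    by (simp add: state_prob_def measure_distr vimage_def)
  also have "\<dots> = sum (pmf (marginal_law P \<pi> s\<^sub>0 t)) ?A"
    by (simp add: distr_trajectory_law measure_measure_pmf_finite)
  also have "?A = Pair s ` UNIV" by (auto simp: image_iff)
  finally show ?thesis by (simp add: sum.reindex inj_on_def)
qed

lemma state_prob_nonneg: "0 \<le> state_prob P \<pi> s\<^sub>0 t s"
  by (simp add: state_prob_def)

lemma state_prob_total: "(\<Sum>s\<in>UNIV. state_prob P \<pi> s\<^sub>0 t s) = 1"
proof -
  have "(\<Sum>s\<in>UNIV. state_prob P \<pi> s\<^sub>0 t s) = sum (pmf (marginal_law P \<pi> s\<^sub>0 t)) (UNIV \<times> UNIV)"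
    by (simp add: state_prob_eq_sum sum.cartesian_product)
  also have "\<dots> = 1" by (rule sum_pmf_eq_1) auto
  finally show ?thesis .
qed

context
  fixes P :: "('s::finite, 'a::finite) kernel" and \<pi> :: "('s, 'a) policy"
  assumes P: "P \<in> kernels" and \<pi>: "\<pi> \<in> policies"
begin

lemma sum_policy: "(\<Sum>a\<in>UNIV. \<pi> $ s $ a) = 1"
  using \<pi> by (simp add: policies_def prob_simplex_def)

lemma state_prob_0: "state_prob P \<pi> s\<^sub>0 0 s = of_bool (s = s\<^sub>0)"
  by (simp add: state_prob_eq_sum pmf_act_law[OF \<pi>] sum_distrib_left[symmetric] sum_policy pmf_return indicator_def)

lemma pmf_marginal_law:
  "pmf (marginal_law P \<pi> s\<^sub>0 t) (s, a) = state_prob P \<pi> s\<^sub>0 t s * \<pi> $ s $ a"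
proof -
  \<comment> \<open>At every time the action is drawn last, from \<open>\<pi>\<close> given the state.\<close>
  obtain p where "marginal_law P \<pi> s\<^sub>0 t = act_law \<pi> p"
  proof (cases t)
    case (Suc n)
    have "marginal_law P \<pi> s\<^sub>0 (Suc n) =
        act_law \<pi> (bind_pmf (marginal_law P \<pi> s\<^sub>0 n) (\<lambda>x. simplex_pmf (P $ fst x $ snd x)))"
      by (simp add: act_law_def bind_assoc_pmf)
    with that Suc show ?thesis by blast
  qed (use that in auto)
  then show ?thesis
    by (simp add: state_prob_eq_sum pmf_act_law[OF \<pi>] sum_distrib_left[symmetric] sum_policy)
qed

lemma state_prob_Suc:
  "state_prob P \<pi> s\<^sub>0 (Suc t) s' = (\<Sum>s\<in>UNIV. state_prob P \<pi> s\<^sub>0 t s * transition_matrix P \<pi> $ s $ s')"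
proof -
  have row: "P $ s $ a \<in> prob_simplex" for s a using P by (simp add: kernels_def)
  have "pmf (marginal_law P \<pi> s\<^sub>0 (Suc t)) (s', a) =
      (\<Sum>x\<in>UNIV \<times> UNIV. P $ fst x $ snd x $ s' * \<pi> $ s' $ a * pmf (marginal_law P \<pi> s\<^sub>0 t) x)" for a
    by (simp add: pmf_bind integral_measure_pmf_real[of UNIV] pmf_act_law[OF \<pi>] pmf_simplex_pmf[OF row]
        sum_distrib_left sum_distrib_right mult_ac)
  also have "\<dots>a = (\<Sum>s\<in>UNIV. \<Sum>b\<in>UNIV. P $ s $ b $ s' * \<pi> $ s' $ a * (state_prob P \<pi> s\<^sub>0 t s * \<pi> $ s $ b))" for a
    by (subst sum.cartesian_product) (auto simp: pmf_marginal_law intro!: sum.cong)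
  finally have "state_prob P \<pi> s\<^sub>0 (Suc t) s' =
     (\<Sum>a\<in>UNIV. \<pi> $ s' $ a * (\<Sum>s\<in>UNIV. \<Sum>b\<in>UNIV. P $ s $ b $ s' * (state_prob P \<pi> s\<^sub>0 t s * \<pi> $ s $ b)))"
    unfolding state_prob_eq_sum[of _ _ _ "Suc t"] by (simp add: sum_distrib_left mult_ac)
  also have "\<dots> = (\<Sum>s\<in>UNIV. \<Sum>b\<in>UNIV. P $ s $ b $ s' * (state_prob P \<pi> s\<^sub>0 t s * \<pi> $ s $ b))"
    by (simp add: sum_distrib_right[symmetric] sum_policy)
  finally show ?thesis by (simp add: transition_matrix_def sum_distrib_left mult_ac)
qed

text \<open>
  With \<open>y\<close> the resolvent applied to \<open>x\<close> and \<open>e t\<close> the expectation of \<open>y\<close> at time \<open>t\<close>, the Bellman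
  equation \<open>x = y - \<gamma> P\<^sub>\<pi> y\<close> turns the series into the telescoping sum of
  \<open>\<gamma>\<^sup>t e t - \<gamma>\<^sup>t\<^sup>+\<^sup>1 e (t + 1)\<close>.  Unit vectors \<open>x\<close> give the visitation frequencies, the stage cost gives
  the value.
\<close>
lemma discounted_state_sum:
  assumes \<gamma>: "0 < \<gamma>" "\<gamma> < 1"
  shows "(\<lambda>t. \<gamma> ^ t * (\<Sum>s\<in>UNIV. state_prob P \<pi> s\<^sub>0 t s * x $ s)) sums (resolvent \<gamma> \<pi> P *v x) $ s\<^sub>0"
proof -
  interpret discounted_policy \<gamma> \<pi> by unfold_locales (use \<gamma> \<pi> in auto)
  define y where "y = resolvent \<gamma> \<pi> P *v x"
  define e where "e t = (\<Sum>s\<in>UNIV. state_prob P \<pi> s\<^sub>0 t s * y $ s)" for t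
  have "bellman_matrix \<gamma> \<pi> P *v y = x"
    unfolding y_def by (rule bellman_resolvent[OF invertible_bellman[OF P]])
  then have x: "x $ s = y $ s - \<gamma> * (transition_matrix P \<pi> *v y) $ s" for s
    by (metis bellman_matrix_nth)
  have step: "e (Suc t) = (\<Sum>s\<in>UNIV. state_prob P \<pi> s\<^sub>0 t s * (transition_matrix P \<pi> *v y) $ s)" for t
    unfolding e_def state_prob_Suc matrix_vector_mult_def
    by (simp add: sum_distrib_left sum_distrib_right mult_ac, rule sum.swap)
  have tele: "\<gamma> ^ t * (\<Sum>s\<in>UNIV. state_prob P \<pi> s\<^sub>0 t s * x $ s) = \<gamma> ^ t * e t - \<gamma> ^ Suc t * e (Suc t)" for t
    unfolding step unfolding e_def x by (simp add: algebra_simps sum_subtractf sum_distrib_left)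
  define B where "B = (MAX s\<in>UNIV. \<bar>y $ s\<bar>)"
  have B: "\<bar>y $ s\<bar> \<le> B" for s by (simp add: B_def)
  have "\<bar>e t\<bar> \<le> B" for t
  proof -
    have "\<bar>e t\<bar> \<le> (\<Sum>s\<in>UNIV. state_prob P \<pi> s\<^sub>0 t s * B)"
      unfolding e_def
      by (rule order_trans[OF sum_abs sum_mono]) (simp add: abs_mult state_prob_nonneg B mult_left_mono)
    then show ?thesis by (simp add: sum_distrib_right[symmetric] state_prob_total)
  qed
  then have "(\<lambda>t. \<gamma> ^ t * e t) \<longlonglongrightarrow> 0"
    using \<gamma> by (intro lim_null_mult_right_bounded[where B = B] LIMSEQ_power_zero)
      (auto simp: )
  from telescope_sums'[OF this] tele
  have "(\<lambda>t. \<gamma> ^ t * (\<Sum>s\<in>UNIV. state_prob P \<pi> s\<^sub>0 t s * x $ s)) sums (e 0)"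
    by simp
  moreover have "e 0 = y $ s\<^sub>0" by (simp add: e_def state_prob_0)
  ultimately show ?thesis by (simp add: y_def)
qed

lemma visitation_eq_resolvent:
  assumes \<gamma>: "0 < \<gamma>" "\<gamma> < 1"
  shows "visitation \<gamma> \<pi> s\<^sub>0 P s = (1 - \<gamma>) * resolvent \<gamma> \<pi> P $ s\<^sub>0 $ s"
    and "(\<lambda>t. \<gamma> ^ t * state_prob P \<pi> s\<^sub>0 t s) sums (resolvent \<gamma> \<pi> P $ s\<^sub>0 $ s)"
proof -
  have "(resolvent \<gamma> \<pi> P *v axis s 1) $ s\<^sub>0 = resolvent \<gamma> \<pi> P $ s\<^sub>0 $ s"
    by (simp add: matrix_vector_mult_def axis_def if_distrib cong: if_cong)
  moreover have "(\<Sum>s'\<in>UNIV. state_prob P \<pi> s\<^sub>0 t s' * axis s 1 $ s') = state_prob P \<pi> s\<^sub>0 t s" for t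
    by (simp add: axis_def if_distrib cong: if_cong)
  ultimately show s: "(\<lambda>t. \<gamma> ^ t * state_prob P \<pi> s\<^sub>0 t s) sums (resolvent \<gamma> \<pi> P $ s\<^sub>0 $ s)"
    using discounted_state_sum[OF \<gamma>, of s\<^sub>0 "axis s 1"] by simp
  then show "visitation \<gamma> \<pi> s\<^sub>0 P s = (1 - \<gamma>) * resolvent \<gamma> \<pi> P $ s\<^sub>0 $ s"
    by (simp add: visitation_def sums_unique[symmetric])
qed

lemma value_fun_eq_value_ext:
  assumes \<gamma>: "0 < \<gamma>" "\<gamma> < 1"
  shows "value_fun \<gamma> c \<pi> s\<^sub>0 P = value_ext \<gamma> c \<pi> s\<^sub>0 P"
proof -
  let ?\<mu> = "trajectory_law P \<pi> s\<^sub>0" and ?f = "\<lambda>t \<omega>. \<gamma> ^ t * c (fst (\<omega> t)) (snd (\<omega> t))"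
  have "prob_space (distr ?\<mu> (count_space UNIV) (\<lambda>\<omega>. \<omega> 0))"
    by (simp only: distr_trajectory_law prob_space_measure_pmf)
  then interpret \<mu>: prob_space ?\<mu> by (rule prob_space_distrD[rotated]) measurable
  define B where "B = (MAX x\<in>UNIV. \<bar>c (fst x) (snd x)\<bar>)"
  have B: "\<bar>c s a\<bar> \<le> B" for s a
    unfolding B_def by (intro Max_ge) (auto intro: image_eqI[of _ _ "(s, a)"])
  have f_bound: "\<bar>?f t \<omega>\<bar> \<le> \<gamma> ^ t * B" for t \<omega>
    using \<gamma> B by (auto simp: abs_mult intro!: mult_left_mono)
  have meas: "?f t \<in> borel_measurable ?\<mu>" for t
    by (rule measurable_compose[OF measurable_coordinate, of "\<lambda>x. \<gamma> ^ t * c (fst x) (snd x)"]) simp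
  have int: "integrable ?\<mu> (?f t)" for t
    by (rule \<mu>.integrable_const_bound[OF _ meas, where B = "\<gamma> ^ t * B"]) (use f_bound in auto)
  have sumB: "summable (\<lambda>t. \<gamma> ^ t * B)"
    using \<gamma> by (intro summable_mult2 summable_geometric) auto
  have "value_fun \<gamma> c \<pi> s\<^sub>0 P = (\<Sum>t. LINT \<omega>|?\<mu>. ?f t \<omega>)"
    unfolding value_fun_def
  proof (rule integral_suminf[OF int])
    show "AE \<omega> in ?\<mu>. summable (\<lambda>t. norm (?f t \<omega>))"
      using f_bound by (intro AE_I2 summable_comparison_test'[OF sumB]) auto
    have "(LINT \<omega>|?\<mu>. norm (?f t \<omega>)) \<le> \<gamma> ^ t * B" for t
      using f_bound int by (intro \<mu>.integral_le_const) auto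
    then show "summable (\<lambda>t. LINT \<omega>|?\<mu>. norm (?f t \<omega>))"
      by (intro summable_comparison_test'[OF sumB]) (auto simp: abs_of_nonneg integral_nonneg_AE)
  qed
  also have "(\<lambda>t. LINT \<omega>|?\<mu>. ?f t \<omega>) =
      (\<lambda>t. \<gamma> ^ t * (\<Sum>s\<in>UNIV. state_prob P \<pi> s\<^sub>0 t s * stage_cost c \<pi> $ s))"
  proof
    fix t
    have "(LINT \<omega>|?\<mu>. ?f t \<omega>) = (LINT x|distr ?\<mu> (count_space UNIV) (\<lambda>\<omega>. \<omega> t). \<gamma> ^ t * c (fst x) (snd x))"
      by (rule integral_distr[symmetric]) auto
    also have "\<dots> = (\<Sum>x\<in>UNIV \<times> UNIV. \<gamma> ^ t * c (fst x) (snd x) * pmf (marginal_law P \<pi> s\<^sub>0 t) x)"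
      unfolding distr_trajectory_law by (rule integral_measure_pmf_real) auto
    also have "\<dots> = (\<Sum>s\<in>UNIV. \<Sum>a\<in>UNIV. \<gamma> ^ t * c s a * (state_prob P \<pi> s\<^sub>0 t s * \<pi> $ s $ a))"
      by (subst sum.cartesian_product) (auto simp: pmf_marginal_law intro!: sum.cong)
    finally show "(LINT \<omega>|?\<mu>. ?f t \<omega>) =
        \<gamma> ^ t * (\<Sum>s\<in>UNIV. state_prob P \<pi> s\<^sub>0 t s * stage_cost c \<pi> $ s)"
      by (simp add: stage_cost_def sum_distrib_left mult_ac)
  qed
  also have "(\<Sum>t. \<gamma> ^ t * (\<Sum>s\<in>UNIV. state_prob P \<pi> s\<^sub>0 t s * stage_cost c \<pi> $ s)) = value_ext \<gamma> c \<pi> s\<^sub>0 P"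
    using discounted_state_sum[OF \<gamma>] by (simp add: value_ext_eq value_vec_def sums_unique[symmetric])
  finally show ?thesis .
qed

end

section \<open>The gradient of the value function\<close>

text \<open>
  The slope of the value function between \<open>P\<close> and \<open>Q\<close>: the usual formula for the gradient
  with respect to the kernel, but with the visitation frequencies of \<open>Q\<close> and the value function of
  \<open>P\<close>.  On the diagonal \<open>Q = P\<close> it is the gradient.
\<close>
definition cross_grad ::
  "real \<Rightarrow> ('s::finite \<Rightarrow> 'a::finite \<Rightarrow> real) \<Rightarrow> ('s, 'a) policy \<Rightarrow> 's \<Rightarrow> ('s, 'a) kernel \<Rightarrow> ('s, 'a) kernel
    \<Rightarrow> ('s, 'a) kernel" where
  "cross_grad \<gamma> c \<pi> s\<^sub>0 P Q =
     (\<chi> s a s'. \<gamma> * resolvent \<gamma> \<pi> Q $ s\<^sub>0 $ s * \<pi> $ s $ a * value_vec \<gamma> c \<pi> P $ s')"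

lemma cross_grad_inner:
  "cross_grad \<gamma> c \<pi> s\<^sub>0 P Q \<bullet> D =
     \<gamma> * (resolvent \<gamma> \<pi> Q *v (transition_matrix D \<pi> *v value_vec \<gamma> c \<pi> P)) $ s\<^sub>0"
proof -
  have "(\<Sum>a\<in>UNIV. \<Sum>s'\<in>UNIV. \<pi> $ s $ a * value_vec \<gamma> c \<pi> P $ s' * D $ s $ a $ s') =
      (transition_matrix D \<pi> *v value_vec \<gamma> c \<pi> P) $ s" for s
    by (subst sum.swap) (simp add: transition_matrix_def matrix_vector_mult_def sum_distrib_right sum_distrib_left mult_ac)
  note row = this[symmetric]
  show ?thesis
    unfolding matrix_vector_mult_def[of "resolvent \<gamma> \<pi> Q"]
    by (simp add: row cross_grad_def inner_vec_def sum_distrib_left mult_ac)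
qed

text \<open>
  The resolvent identity.  Apply the Bellman matrix of \<open>Q\<close> to both sides.
\<close>
lemma resolvent_diff:
  assumes "invertible (bellman_matrix \<gamma> \<pi> P)" "invertible (bellman_matrix \<gamma> \<pi> Q)"
  shows "resolvent \<gamma> \<pi> Q *v x - resolvent \<gamma> \<pi> P *v x =
     resolvent \<gamma> \<pi> Q *v (\<gamma> *\<^sub>R (transition_matrix (Q - P) \<pi> *v (resolvent \<gamma> \<pi> P *v x)))"
proof -
  let ?y = "resolvent \<gamma> \<pi> P *v x"
  have "bellman_matrix \<gamma> \<pi> P *v ?y - bellman_matrix \<gamma> \<pi> Q *v ?y =
      \<gamma> *\<^sub>R (transition_matrix (Q - P) \<pi> *v ?y)"
    by (simp add: vec_eq_iff bellman_matrix_nth transition_matrix_diff matrix_vector_mult_diff_rdistrib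
        right_diff_distrib)
  then have "x - bellman_matrix \<gamma> \<pi> Q *v ?y = \<gamma> *\<^sub>R (transition_matrix (Q - P) \<pi> *v ?y)"
    by (simp add: bellman_resolvent[OF assms(1)])
  then have "resolvent \<gamma> \<pi> Q *v (x - bellman_matrix \<gamma> \<pi> Q *v ?y) =
      resolvent \<gamma> \<pi> Q *v (\<gamma> *\<^sub>R (transition_matrix (Q - P) \<pi> *v ?y))"
    by simp
  then show ?thesis
    by (simp add: matrix_vector_mult_diff_distrib bellman_resolvent[OF assms(2)])
qed

lemma value_difference:
  assumes "invertible (bellman_matrix \<gamma> \<pi> P)" "invertible (bellman_matrix \<gamma> \<pi> Q)"
  shows "value_ext \<gamma> c \<pi> s\<^sub>0 Q - value_ext \<gamma> c \<pi> s\<^sub>0 P = cross_grad \<gamma> c \<pi> s\<^sub>0 P Q \<bullet> (Q - P)"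
  using arg_cong[OF resolvent_diff[OF assms, of "stage_cost c \<pi>"], of "\<lambda>v. v $ s\<^sub>0"]
  by (simp add: value_ext_eq cross_grad_inner value_vec_def matrix_vector_mult_scaleR)

text \<open>
  Caratheodory's characterisation of the derivative: exact slopes that are continuous at the point
  yield the derivative of the value function without differentiating an inverse matrix.
\<close>
lemma GDERIV_of_slope:
  fixes f :: "'v::real_inner \<Rightarrow> real"
  assumes slope: "\<forall>\<^sub>F y in nhds x. f y - f x = h y \<bullet> (y - x)" and cont: "isCont h x"
  shows "GDERIV f x :> h x"
  unfolding gderiv_def has_derivative_at_within
proof (intro conjI bounded_linear_inner_left)
  have lim: "((\<lambda>y. norm (h y - h x)) \<longlongrightarrow> 0) (at x)"
    using cont unfolding isCont_def by (intro tendsto_norm_zero LIM_zero)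
  have "\<forall>\<^sub>F y in at x. norm ((f y - f x - (y - x) \<bullet> h x) /\<^sub>R norm (y - x)) \<le> norm (h y - h x)"
    using slope[unfolded eventually_nhds_conv_at, THEN conjunct1] eventually_neq_at_within[of x x UNIV]
  proof eventually_elim
    case (elim y)
    have "f y - f x - (y - x) \<bullet> h x = (h y - h x) \<bullet> (y - x)"
      by (simp only: elim(1) inner_commute[of "y - x" "h x"] inner_diff_left[of "h y" "h x"])
    then have "\<bar>f y - f x - (y - x) \<bullet> h x\<bar> \<le> norm (h y - h x) * norm (y - x)"
      by (simp add: Cauchy_Schwarz_ineq2)
    with elim show ?case by (simp add: field_simps)
  qed
  then show "((\<lambda>y. (f y - f x - (y - x) \<bullet> h x) /\<^sub>R norm (y - x)) \<longlongrightarrow> 0) (at x)"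
    by (rule Lim_null_comparison) (rule lim)
qed

lemma isCont_bellman_matrix: "isCont (\<lambda>P. bellman_matrix \<gamma> \<pi> P $ i $ j) P"
proof -
  have "(\<lambda>P. bellman_matrix \<gamma> \<pi> P $ i $ j) =
      (\<lambda>P. mat 1 $ i $ j - \<gamma> * (\<Sum>a\<in>UNIV. P $ i $ a $ j * \<pi> $ i $ a))"
    by (simp add: bellman_matrix_def transition_matrix_def)
  then show ?thesis by (simp only:) (intro continuous_intros)
qed

lemma isCont_resolvent:
  assumes "invertible (bellman_matrix \<gamma> \<pi> P)"
  shows "isCont (\<lambda>P. resolvent \<gamma> \<pi> P $ i $ j) P"
proof -
  have "(A *v axis j 1) $ i = A $ i $ j" for A :: "real^'n^'n" and i j
    by (simp add: matrix_vector_mult_def axis_def if_distrib cong: if_cong)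
  note entry = this
  show ?thesis
    using isCont_matrix_inv_mult[OF isCont_bellman_matrix assms, of "axis j 1" i]
    by (simp only: entry resolvent_def)
qed

lemma value_grad_eq:
  assumes inv: "invertible (bellman_matrix \<gamma> \<pi> P)"
  shows "value_grad \<gamma> c \<pi> s\<^sub>0 P = cross_grad \<gamma> c \<pi> s\<^sub>0 P P"
proof -
  have "\<forall>\<^sub>F Q in nhds P. value_ext \<gamma> c \<pi> s\<^sub>0 Q - value_ext \<gamma> c \<pi> s\<^sub>0 P = cross_grad \<gamma> c \<pi> s\<^sub>0 P Q \<bullet> (Q - P)"
    using eventually_invertible[OF isCont_bellman_matrix inv] by eventually_elim (rule value_difference[OF inv])
  moreover have "isCont (cross_grad \<gamma> c \<pi> s\<^sub>0 P) P"
    unfolding cross_grad_def[abs_def] isCont_def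
    by (intro tendsto_vec_lambda tendsto_mult tendsto_const isCont_resolvent[OF inv, unfolded isCont_def])
  ultimately have D: "GDERIV (value_ext \<gamma> c \<pi> s\<^sub>0) P :> cross_grad \<gamma> c \<pi> s\<^sub>0 P P"
    by (rule GDERIV_of_slope)
  have "D' = cross_grad \<gamma> c \<pi> s\<^sub>0 P P" if "GDERIV (value_ext \<gamma> c \<pi> s\<^sub>0) P :> D'" for D'
  proof -
    have "(\<lambda>h. h \<bullet> D') = (\<lambda>h. h \<bullet> cross_grad \<gamma> c \<pi> s\<^sub>0 P P)"
      using that D unfolding gderiv_def by (rule has_derivative_unique)
    then show ?thesis by (metis inner_commute vector_eq_ldot)
  qed
  with D show ?thesis unfolding value_grad_def gradient_def by blast
qed

section \<open>Bounds on values and gradients, and the gain of a step\<close>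

lemma (in discounted_policy) resolvent_abs_bound:
  assumes "P \<in> kernels" "\<And>s. \<bar>x $ s\<bar> \<le> b"
  shows "\<bar>(resolvent \<gamma> \<pi> P *v x) $ s\<bar> \<le> b / (1 - \<gamma>)"
  by (rule bellman_abs_bound[OF assms(1)])
    (simp add: bellman_resolvent[OF invertible_bellman[OF assms(1)]] assms(2))

lemma (in discounted_policy) resolvent_nonneg:
  assumes "P \<in> kernels" "\<And>s. 0 \<le> x $ s"
  shows "0 \<le> (resolvent \<gamma> \<pi> P *v x) $ s"
  by (rule bellman_minimum_principle[OF discount assms(1) policy])
    (simp add: bellman_resolvent[OF invertible_bellman[OF assms(1)]] assms(2))

text \<open>
  A difference of two averages of \<open>x\<close> is bounded by the oscillation of \<open>x\<close>, not by twice its norm.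
  For value functions, which lie between \<open>0\<close> and \<open>1 / (1 - \<gamma>)\<close>, this saves the factor 2 that makes the
  constant of \<open>ascent_lower_bound\<close> match the prescribed stepsize.
\<close>
lemma (in discounted_policy) kernel_diff_oscillation:
  assumes "P \<in> kernels" "Q \<in> kernels" "\<And>s. lo \<le> x $ s" "\<And>s. x $ s \<le> hi"
  shows "\<bar>(transition_matrix (Q - P) \<pi> *v x) $ s\<bar> \<le> hi - lo"
proof -
  have "lo \<le> (transition_matrix R \<pi> *v x) $ s \<and> (transition_matrix R \<pi> *v x) $ s \<le> hi"
    if "R \<in> kernels" for R
    using that assms(3,4) policy by (intro conjI simplex_average_ge simplex_average_le transition_matrix_simplex)
  from this[OF assms(1)] this[OF assms(2)] show ?thesis
    by (simp add: transition_matrix_diff matrix_vector_mult_diff_rdistrib abs_le_iff)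
qed

locale discounted_mdp = discounted_policy \<gamma> \<pi> for \<gamma> and \<pi> :: "('s::finite, 'a::finite) policy" +
  fixes c :: "'s \<Rightarrow> 'a \<Rightarrow> real" and s\<^sub>0 :: 's
  assumes cost: "\<And>s a. 0 \<le> c s a \<and> c s a \<le> 1"
begin

abbreviation grad :: "('s, 'a) kernel \<Rightarrow> ('s, 'a) kernel" where
  "grad \<equiv> value_grad \<gamma> c \<pi> s\<^sub>0"

abbreviation val :: "('s, 'a) kernel \<Rightarrow> real" where
  "val \<equiv> value_ext \<gamma> c \<pi> s\<^sub>0"

lemma one_minus_discount_pos: "0 < 1 - \<gamma>"
  using discount by simp

lemma stage_cost_range: "0 \<le> stage_cost c \<pi> $ s" "stage_cost c \<pi> $ s \<le> 1"
proof -
  have p: "0 \<le> \<pi> $ s $ a" "(\<Sum>a\<in>UNIV. \<pi> $ s $ a) = 1" for a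
    using policy by (auto simp: policies_def prob_simplex_def)
  show "0 \<le> stage_cost c \<pi> $ s"
    using p cost by (auto simp: stage_cost_def intro!: sum_nonneg)
  have "(\<Sum>a\<in>UNIV. \<pi> $ s $ a * c s a) \<le> (\<Sum>a\<in>UNIV. \<pi> $ s $ a * 1)"
    using p cost by (intro sum_mono mult_left_mono) auto
  then show "stage_cost c \<pi> $ s \<le> 1" by (simp add: stage_cost_def p)
qed

lemma value_vec_range:
  assumes "P \<in> kernels"
  shows "0 \<le> value_vec \<gamma> c \<pi> P $ s" "value_vec \<gamma> c \<pi> P $ s \<le> 1 / (1 - \<gamma>)"
  using resolvent_nonneg[OF assms, of "stage_cost c \<pi>" s] resolvent_abs_bound[OF assms, of "stage_cost c \<pi>" 1 s]
    stage_cost_range by (auto simp: value_vec_def)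

lemma value_range: "P \<in> kernels \<Longrightarrow> 0 \<le> val P \<and> val P \<le> 1 / (1 - \<gamma>)"
  by (simp add: value_ext_eq value_vec_range)

lemma grad_inner:
  "P \<in> kernels \<Longrightarrow> grad P \<bullet> D =
    \<gamma> * (resolvent \<gamma> \<pi> P *v (transition_matrix D \<pi> *v value_vec \<gamma> c \<pi> P)) $ s\<^sub>0"
  by (simp add: value_grad_eq[OF invertible_bellman] cross_grad_inner)

lemma grad_inner_range:
  assumes "P \<in> kernels" "Q \<in> kernels"
  shows "0 \<le> grad P \<bullet> Q" "grad P \<bullet> Q \<le> \<gamma> / (1 - \<gamma>)\<^sup>2"
proof -
  let ?w = "transition_matrix Q \<pi> *v value_vec \<gamma> c \<pi> P"
  have w: "0 \<le> ?w $ s" "?w $ s \<le> 1 / (1 - \<gamma>)" for s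
    using value_vec_range[OF assms(1)] assms(2) policy
    by (auto intro!: simplex_average_ge simplex_average_le transition_matrix_simplex)
  show "0 \<le> grad P \<bullet> Q"
    unfolding grad_inner[OF assms(1)] using discount resolvent_nonneg[OF assms(1) w(1)] by simp
  have "(resolvent \<gamma> \<pi> P *v ?w) $ s\<^sub>0 \<le> 1 / (1 - \<gamma>) / (1 - \<gamma>)"
    using resolvent_abs_bound[OF assms(1), of ?w "1 / (1 - \<gamma>)" s\<^sub>0] w by auto
  then have "\<gamma> * (resolvent \<gamma> \<pi> P *v ?w) $ s\<^sub>0 \<le> \<gamma> * (1 / (1 - \<gamma>) / (1 - \<gamma>))"
    using discount by (intro mult_left_mono) auto
  then show "grad P \<bullet> Q \<le> \<gamma> / (1 - \<gamma>)\<^sup>2"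
    unfolding grad_inner[OF assms(1)] by (simp add: power2_eq_square)
qed

text \<open>
  The slope between \<open>P\<close> and \<open>R\<close> differs from the gradient at \<open>P\<close> only in the resolvent, and a second
  use of the resolvent identity makes the difference explicit:
  the remainder is \<open>\<gamma>\<^sup>2 \<alpha>\<^sup>2\<close> times an entry of \<open>N\<^sup>R D N\<^sup>P D V\<^sup>P\<close> with \<open>D = (Q - P)\<^sub>\<pi>\<close>.
  Each resolvent contributes a factor \<open>1 / (1 - \<gamma>)\<close>, the inner \<open>D V\<^sup>P\<close> another one, and the outer
  \<open>D\<close> a factor 2.
\<close>
lemma ascent_lower_bound:
  assumes P: "P \<in> kernels" and Q: "Q \<in> kernels" and R: "R \<in> kernels" "R - P = \<alpha> *\<^sub>R (Q - P)"
  shows "val R - val P \<ge> \<alpha> * (grad P \<bullet> (Q - P)) - 2 * \<gamma>\<^sup>2 * \<alpha>\<^sup>2 / (1 - \<gamma>) ^ 3"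
proof -
  note inv = invertible_bellman[OF P] invertible_bellman[OF R(1)]
  define b where "b = 1 / (1 - \<gamma>)"
  define w where "w = transition_matrix (Q - P) \<pi> *v value_vec \<gamma> c \<pi> P"
  define x where "x = resolvent \<gamma> \<pi> P *v w"
  define z where "z = transition_matrix (Q - P) \<pi> *v x"
  have "\<bar>w $ s\<bar> \<le> b" for s
    using kernel_diff_oscillation[OF P Q, of 0 "value_vec \<gamma> c \<pi> P" b s] value_vec_range[OF P]
    by (simp add: w_def b_def)
  then have x_bound: "\<bar>x $ s\<bar> \<le> b\<^sup>2" for s
    using resolvent_abs_bound[OF P, of w b s] by (simp add: x_def b_def power2_eq_square)
  have x_range: "- b\<^sup>2 \<le> x $ s" "x $ s \<le> b\<^sup>2" for s
    using x_bound[of s] by linarith+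
  have "\<bar>z $ s\<bar> \<le> 2 * b\<^sup>2" for s
    using kernel_diff_oscillation[OF P Q x_range, of s] unfolding z_def by linarith
  then have z_bound: "\<bar>(resolvent \<gamma> \<pi> R *v z) $ s\<^sub>0\<bar> \<le> 2 * b ^ 3"
    using resolvent_abs_bound[OF R(1), of z "2 * b\<^sup>2" s\<^sub>0] by (simp add: b_def power_divide power3_eq_cube power2_eq_square)
  have "val R - val P = \<gamma> * \<alpha> * (resolvent \<gamma> \<pi> R *v w) $ s\<^sub>0"
    unfolding value_difference[OF inv] cross_grad_inner R(2)
    by (simp add: transition_matrix_scaleR w_def scaleR_matrix_vector_assoc[symmetric] matrix_vector_mult_scaleR)
  moreover have "(resolvent \<gamma> \<pi> R *v w) $ s\<^sub>0 - x $ s\<^sub>0 = \<gamma> * \<alpha> * (resolvent \<gamma> \<pi> R *v z) $ s\<^sub>0"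
    using arg_cong[OF resolvent_diff[OF inv, of w], of "\<lambda>v. v $ s\<^sub>0"]
    by (simp add: R(2) x_def[symmetric] z_def transition_matrix_scaleR
        scaleR_matrix_vector_assoc[symmetric] matrix_vector_mult_scaleR)
  moreover have "grad P \<bullet> (Q - P) = \<gamma> * x $ s\<^sub>0"
    by (simp add: grad_inner[OF P] x_def w_def)
  ultimately have "val R - val P =
      \<alpha> * (grad P \<bullet> (Q - P)) + \<gamma>\<^sup>2 * \<alpha>\<^sup>2 * (resolvent \<gamma> \<pi> R *v z) $ s\<^sub>0"
    by (simp add: algebra_simps power2_eq_square)
  moreover have "\<bar>\<gamma>\<^sup>2 * \<alpha>\<^sup>2 * (resolvent \<gamma> \<pi> R *v z) $ s\<^sub>0\<bar> \<le> \<gamma>\<^sup>2 * \<alpha>\<^sup>2 * (2 * b ^ 3)"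
    unfolding abs_mult using z_bound by (intro mult_mono) auto
  ultimately show ?thesis by (simp add: b_def power_divide abs_le_iff)
qed

lemma frank_wolfe_progress:
  assumes P: "P \<in> kernels" and Q: "Q \<in> kernels" and R: "R \<in> kernels"
    and G: "G = grad P \<bullet> (Q - P)"
    and step: "\<alpha> = G * (1 - \<gamma>) ^ 3 / (4 * \<gamma>\<^sup>2)" "R = (1 - \<alpha>) *\<^sub>R P + \<alpha> *\<^sub>R Q"
  shows "val R - val P \<ge> G\<^sup>2 * (1 - \<gamma>) ^ 3 / (8 * \<gamma>\<^sup>2)"
proof -
  have "R - P = \<alpha> *\<^sub>R (Q - P)" by (simp add: step(2) algebra_simps)
  from ascent_lower_bound[OF P Q R this]
  have "\<alpha> * G - 2 * \<gamma>\<^sup>2 * \<alpha>\<^sup>2 / (1 - \<gamma>) ^ 3 \<le> val R - val P" by (simp add: G)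
  \<comment> \<open>The stepsize maximises the left-hand side, a concave quadratic function of \<open>\<alpha>\<close>.\<close>
  moreover have "\<alpha> * G - 2 * g * \<alpha>\<^sup>2 / d = G\<^sup>2 * d / (8 * g)"
    if "0 < d" "0 < g" "\<alpha> = G * d / (4 * g)" for d g
    using that(1,2) unfolding that(3) by (simp add: field_simps power2_eq_square)
  note this[of "(1 - \<gamma>) ^ 3" "\<gamma>\<^sup>2", OF _ _ step(1)]
  ultimately show ?thesis using discount by simp
qed

text \<open>
  The slope is at most \<open>\<gamma> / (1 - \<gamma>)\<^sup>2\<close>, so the stepsize is at most \<open>(1 - \<gamma>) / (4 \<gamma>)\<close>, which is at most
  1 exactly if \<open>\<gamma> \<ge> 1 / 5\<close>.
\<close>
lemma step_size_le_1:
  assumes "P \<in> kernels" "Q \<in> kernels" "1 / 5 \<le> \<gamma>"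
  shows "(grad P \<bullet> (Q - P)) * (1 - \<gamma>) ^ 3 / (4 * \<gamma>\<^sup>2) \<le> 1"
proof -
  have "grad P \<bullet> (Q - P) \<le> \<gamma> / (1 - \<gamma>)\<^sup>2"
    using grad_inner_range[OF assms(1,1)] grad_inner_range[OF assms(1,2)] by (simp add: inner_diff_right)
  then have "(grad P \<bullet> (Q - P)) * (1 - \<gamma>) ^ 3 \<le> \<gamma> / (1 - \<gamma>)\<^sup>2 * (1 - \<gamma>) ^ 3"
    using discount by (intro mult_right_mono) auto
  also have "\<dots> = \<gamma> * (1 - \<gamma>)"
    using discount by (simp add: power2_eq_square power3_eq_cube)
  also have "\<dots> \<le> 4 * \<gamma>\<^sup>2"
    using discount assms(3) by (simp add: power2_eq_square)
  finally show ?thesis using discount by simp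
qed

end

section \<open>The rectangular hull\<close>

text \<open>
  The right-hand side is the product of the projections of \<open>U\<close> to the blocks of the single states,
  and a product that contains \<open>U\<close> has factors that contain these projections.
\<close>
lemma s_rect_hull_eq:
  assumes "U \<subseteq> kernels"
  shows "s_rect_hull U = {P. \<forall>s. \<exists>Q\<in>U. P $ s = Q $ s}"
proof -
  let ?H = "{P. \<forall>s. P $ s \<in> (\<lambda>Q. Q $ s) ` U}"
  have "s_rectangular ?H"
    unfolding s_rectangular_def using assms
    by (intro exI[of _ "\<lambda>s. (\<lambda>Q. Q $ s) ` U"]) (auto simp: kernels_def)
  moreover have "?H \<subseteq> T" if sub: "U \<subseteq> T" and rect: "s_rectangular T" for T
  proof
    fix P assume P: "P \<in> ?H"
    obtain V where T: "T = {P. \<forall>s. P $ s \<in> V s}"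
      using rect by (auto simp: s_rectangular_def)
    have "P $ s \<in> V s" for s
    proof -
      obtain Q where "Q \<in> U" "P $ s = Q $ s" using P by blast
      with sub T show ?thesis by auto
    qed
    then show "P \<in> T" by (simp add: T)
  qed
  ultimately have "s_rectangular hull U = ?H"
    by (intro hull_unique) auto
  then show ?thesis by (auto simp: s_rect_hull_def image_iff)
qed

lemma s_rect_hull_subset_kernels:
  assumes "U \<subseteq> kernels"
  shows "s_rect_hull U \<subseteq> kernels"
proof
  fix P assume "P \<in> s_rect_hull U"
  then have rows: "\<exists>Q\<in>U. P $ s = Q $ s" for s by (simp add: s_rect_hull_eq[OF assms])
  have "P $ s $ a \<in> prob_simplex" for s a
  proof -
    obtain Q where "Q \<in> U" "P $ s = Q $ s" using rows by blast
    with assms show ?thesis by (auto simp: kernels_def)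
  qed
  then show "P \<in> kernels" by (simp add: kernels_def)
qed

lemma subset_s_rect_hull: "U \<subseteq> s_rect_hull U"
  by (simp add: s_rect_hull_def hull_subset)

lemma bounded_kernels: "bounded (kernels :: ('s::finite, 'a::finite) kernel set)"
proof (rule boundedI)
  fix P :: "('s, 'a) kernel" assume "P \<in> kernels"
  then have P: "P $ s $ a \<in> prob_simplex" for s a by (simp add: kernels_def)
  have row: "norm (P $ s $ a) \<le> 1" for s a
    using norm_le_l1_cart[of "P $ s $ a"] P[of s a] by (simp add: prob_simplex_def)
  have "norm (P $ s) \<le> (\<Sum>a\<in>UNIV. norm (P $ s $ a))" for s
    unfolding norm_vec_def[of "P $ s"] by (rule L2_set_le_sum) simp
  also have "(\<Sum>a\<in>UNIV. norm (P $ s $ a)) \<le> real CARD('a)" for s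
    using sum_bounded_above[of UNIV "\<lambda>a. norm (P $ s $ a)" 1] row by simp
  finally have mid: "norm (P $ s) \<le> real CARD('a)" for s .
  have "norm P \<le> (\<Sum>s\<in>UNIV. norm (P $ s))"
    unfolding norm_vec_def[of P] by (rule L2_set_le_sum) simp
  also have "\<dots> \<le> real CARD('s) * real CARD('a)"
    using sum_bounded_above[of UNIV "\<lambda>s. norm (P $ s)" "real CARD('a)"] mid by simp
  finally show "norm P \<le> real CARD('s) * real CARD('a)" .
qed

lemma compact_s_rect_hull:
  assumes "compact U" "U \<subseteq> kernels"
  shows "compact (s_rect_hull U)"
proof (rule compact_eq_bounded_closed[THEN iffD2], rule conjI)
  show "bounded (s_rect_hull U)"
    by (rule bounded_subset[OF bounded_kernels s_rect_hull_subset_kernels[OF assms(2)]])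
  have "closed ((\<lambda>P. P $ s) -` ((\<lambda>Q. Q $ s) ` U))" for s
    using assms(1) by (intro closed_vimage compact_imp_closed compact_continuous_image continuous_intros)
  moreover have "s_rect_hull U = (\<Inter>s. (\<lambda>P. P $ s) -` ((\<lambda>Q. Q $ s) ` U))"
    by (auto simp: s_rect_hull_eq[OF assms(2)] image_iff)
  ultimately show "closed (s_rect_hull U)" by auto
qed

section \<open>Gradient domination on the rectangular hull\<close>

context discounted_mdp
begin

lemma resolvent_entry_range:
  assumes "P \<in> kernels"
  shows "0 \<le> resolvent \<gamma> \<pi> P $ i $ j" "resolvent \<gamma> \<pi> P $ i $ j \<le> 1 / (1 - \<gamma>)"
proof -
  have e: "(resolvent \<gamma> \<pi> P *v axis j 1) $ i = resolvent \<gamma> \<pi> P $ i $ j"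
    by (simp add: matrix_vector_mult_def axis_def if_distrib cong: if_cong)
  show "0 \<le> resolvent \<gamma> \<pi> P $ i $ j"
    using resolvent_nonneg[OF assms, of "axis j 1" i] unfolding e by (simp add: axis_def)
  have "\<bar>axis j (1 :: real) $ s\<bar> \<le> 1" for s by (simp add: axis_def)
  from resolvent_abs_bound[OF assms this, of i]
  show "resolvent \<gamma> \<pi> P $ i $ j \<le> 1 / (1 - \<gamma>)" unfolding e by linarith
qed

lemma resolvent_entry_pos:
  assumes "P \<in> kernels" "irreducible_chain P \<pi>"
  shows "0 < resolvent \<gamma> \<pi> P $ s\<^sub>0 $ s"
proof -
  have sums: "(\<lambda>t. \<gamma> ^ t * state_prob P \<pi> s\<^sub>0 t s) sums (resolvent \<gamma> \<pi> P $ s\<^sub>0 $ s)"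
    by (rule visitation_eq_resolvent(2)[OF assms(1) policy discount])
  obtain t where "0 < state_prob P \<pi> s\<^sub>0 t s"
    using assms(2) by (auto simp: irreducible_chain_def)
  then have "0 < (\<Sum>t. \<gamma> ^ t * state_prob P \<pi> s\<^sub>0 t s)"
    using discount sums
    by (intro suminf_pos2[where i = t]) (auto simp: sums_iff state_prob_nonneg)
  with sums show ?thesis by (simp add: sums_iff)
qed

lemma visitation_ratio:
  assumes "P \<in> kernels" "Q \<in> kernels"
  shows "visitation \<gamma> \<pi> s\<^sub>0 Q s / visitation \<gamma> \<pi> s\<^sub>0 P s =
     resolvent \<gamma> \<pi> Q $ s\<^sub>0 $ s / resolvent \<gamma> \<pi> P $ s\<^sub>0 $ s"
  using one_minus_discount_pos
  by (simp add: visitation_eq_resolvent(1)[OF assms(1) policy discount]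
      visitation_eq_resolvent(1)[OF assms(2) policy discount])

text \<open>
  The slope and the gradient have the same factors apart from the entries of the resolvents of \<open>Q\<close> and
  \<open>P\<close>, which depend on the state only.  Their quotient is that of the visitation distributions, and
  irreducibility makes the denominator positive.
\<close>
lemma performance_difference:
  assumes "P \<in> kernels" "Q \<in> kernels" "irreducible_chain P \<pi>"
  shows "val Q - val P = (\<Sum>s\<in>UNIV.
     visitation \<gamma> \<pi> s\<^sub>0 Q s / visitation \<gamma> \<pi> s\<^sub>0 P s * (grad P $ s \<bullet> (Q $ s - P $ s)))"
proof -
  have row: "cross_grad \<gamma> c \<pi> s\<^sub>0 P Q $ s =
      (visitation \<gamma> \<pi> s\<^sub>0 Q s / visitation \<gamma> \<pi> s\<^sub>0 P s) *\<^sub>R grad P $ s" for s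
    using resolvent_entry_pos[OF assms(1,3), of s]
    by (simp add: visitation_ratio[OF assms(1,2)] value_grad_eq[OF invertible_bellman[OF assms(1)]]
        cross_grad_def vec_eq_iff)
  show ?thesis
    unfolding value_difference[OF invertible_bellman[OF assms(1)] invertible_bellman[OF assms(2)]]
    by (simp add: inner_vec_def[of "cross_grad \<gamma> c \<pi> s\<^sub>0 P Q"] row)
qed

lemma bdd_above_grad_inner:
  assumes "P \<in> kernels" "X \<subseteq> kernels"
  shows "bdd_above ((\<lambda>Q. grad P \<bullet> Q) ` X)"
  using grad_inner_range(2)[OF assms(1)] assms(2) by (intro bdd_aboveI2[where M = "\<gamma> / (1 - \<gamma>)\<^sup>2"]) auto

context
  fixes U :: "('s, 'a) kernel set"
  assumes U: "U \<subseteq> kernels" "compact U"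
    and irred: "\<And>P. P \<in> s_rect_hull U \<Longrightarrow> irreducible_chain P \<pi>"
begin

lemma hull_kernel: "P \<in> s_rect_hull U \<Longrightarrow> P \<in> kernels"
  using s_rect_hull_subset_kernels[OF U(1)] by auto

text \<open>
  On the compact hull the resolvent entries are continuous, positive and hence bounded away from 0.
  Boundedness is what lets the supremum in the mismatch coefficient dominate the individual ratios.
\<close>
lemma bdd_above_mismatch:
  "bdd_above ((\<lambda>(P, P'). MAX s\<in>UNIV. visitation \<gamma> \<pi> s\<^sub>0 P' s / visitation \<gamma> \<pi> s\<^sub>0 P s)
     ` (s_rect_hull U \<times> s_rect_hull U))"
proof -
  let ?H = "s_rect_hull U"
  have "\<exists>K. \<forall>P\<in>?H. inverse (resolvent \<gamma> \<pi> P $ s\<^sub>0 $ s) \<le> K" for s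
  proof -
    have "continuous_on ?H (\<lambda>P. inverse (resolvent \<gamma> \<pi> P $ s\<^sub>0 $ s))"
      using resolvent_entry_pos[OF hull_kernel irred]
      by (intro continuous_on_inverse continuous_at_imp_continuous_on ballI isCont_resolvent
          invertible_bellman hull_kernel) (auto simp: less_le)
    then have "bounded ((\<lambda>P. inverse (resolvent \<gamma> \<pi> P $ s\<^sub>0 $ s)) ` ?H)"
      by (intro compact_imp_bounded compact_continuous_image compact_s_rect_hull U)
    then show ?thesis
      unfolding bounded_iff by (metis abs_le_D1 imageI real_norm_def)
  qed
  then obtain K where K: "\<And>s P. P \<in> ?H \<Longrightarrow> inverse (resolvent \<gamma> \<pi> P $ s\<^sub>0 $ s) \<le> K s"
    by metis
  have "visitation \<gamma> \<pi> s\<^sub>0 P' s / visitation \<gamma> \<pi> s\<^sub>0 P s \<le> (MAX s\<in>UNIV. 1 / (1 - \<gamma>) * K s)"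
    if "P \<in> ?H" "P' \<in> ?H" for P P' s
  proof -
    have "visitation \<gamma> \<pi> s\<^sub>0 P' s / visitation \<gamma> \<pi> s\<^sub>0 P s =
        resolvent \<gamma> \<pi> P' $ s\<^sub>0 $ s * inverse (resolvent \<gamma> \<pi> P $ s\<^sub>0 $ s)"
      unfolding visitation_ratio[OF hull_kernel[OF that(1)] hull_kernel[OF that(2)]]
      by (simp only: divide_inverse)
    also have "\<dots> \<le> 1 / (1 - \<gamma>) * K s"
      using resolvent_entry_range[OF hull_kernel] resolvent_entry_pos[OF hull_kernel irred] K that discount
      by (intro mult_mono) (auto simp: less_imp_le)
    also have "\<dots> \<le> (MAX s\<in>UNIV. 1 / (1 - \<gamma>) * K s)" by (intro Max_ge) auto
    finally show ?thesis .
  qed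
  then show ?thesis
    by (intro bdd_aboveI2[where M = "MAX s\<in>UNIV. 1 / (1 - \<gamma>) * K s"]) (auto intro!: Max.boundedI)
qed

lemma visitation_ratio_le_mismatch:
  assumes "P \<in> s_rect_hull U" "P' \<in> s_rect_hull U"
  shows "visitation \<gamma> \<pi> s\<^sub>0 P' s / visitation \<gamma> \<pi> s\<^sub>0 P s \<le> mismatch_coeff \<gamma> \<pi> s\<^sub>0 U"
proof -
  have "visitation \<gamma> \<pi> s\<^sub>0 P' s / visitation \<gamma> \<pi> s\<^sub>0 P s \<le>
      (MAX s\<in>UNIV. visitation \<gamma> \<pi> s\<^sub>0 P' s / visitation \<gamma> \<pi> s\<^sub>0 P s)"
    by (intro Max_ge) auto
  also have "\<dots> \<le> mismatch_coeff \<gamma> \<pi> s\<^sub>0 U"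
    using cSUP_upper[OF _ bdd_above_mismatch, of "(P, P')"] assms by (simp add: mismatch_coeff_def)
  finally show ?thesis .
qed

lemma visitation_ratio_nonneg:
  assumes "P \<in> s_rect_hull U" "Q \<in> s_rect_hull U"
  shows "0 \<le> visitation \<gamma> \<pi> s\<^sub>0 Q s / visitation \<gamma> \<pi> s\<^sub>0 P s"
  using assms by (simp add: visitation_ratio hull_kernel resolvent_entry_range)

text \<open>
  In the performance difference formula only the states with a positive contribution need to be
  estimated.  Rectangularity allows a kernel \<open>R\<close> that follows \<open>Q\<close> in exactly these states and \<open>P\<close>
  in the others, so that their contributions add up to the directional derivative towards \<open>R\<close>.
\<close>
lemma gradient_domination:
  assumes P: "P \<in> s_rect_hull U" and Q: "Q \<in> s_rect_hull U"
  shows "val Q - val P \<le>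
     mismatch_coeff \<gamma> \<pi> s\<^sub>0 U * ((SUP R\<in>s_rect_hull U. grad P \<bullet> R) - grad P \<bullet> P)"
proof -
  let ?\<delta> = "mismatch_coeff \<gamma> \<pi> s\<^sub>0 U"
  define g where "g s = grad P $ s \<bullet> (Q $ s - P $ s)" for s
  define R where "R = (\<chi> s. if 0 \<le> g s then Q $ s else P $ s)"
  have R: "R \<in> s_rect_hull U"
    using P Q by (auto simp: s_rect_hull_eq[OF U(1)] R_def)
  have \<delta>: "0 \<le> ?\<delta>"
    using visitation_ratio_nonneg[OF P P] visitation_ratio_le_mismatch[OF P P] by (rule order_trans)
  have "val Q - val P = (\<Sum>s\<in>UNIV. visitation \<gamma> \<pi> s\<^sub>0 Q s / visitation \<gamma> \<pi> s\<^sub>0 P s * g s)"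
    unfolding g_def by (rule performance_difference[OF hull_kernel[OF P] hull_kernel[OF Q] irred[OF P]])
  also have "\<dots> \<le> (\<Sum>s\<in>UNIV. ?\<delta> * max 0 (g s))"
  proof (rule sum_mono)
    fix s
    have "visitation \<gamma> \<pi> s\<^sub>0 Q s / visitation \<gamma> \<pi> s\<^sub>0 P s * g s \<le>
        visitation \<gamma> \<pi> s\<^sub>0 Q s / visitation \<gamma> \<pi> s\<^sub>0 P s * max 0 (g s)"
      using visitation_ratio_nonneg[OF P Q] by (intro mult_left_mono) auto
    also have "\<dots> \<le> ?\<delta> * max 0 (g s)"
      using visitation_ratio_le_mismatch[OF P Q] by (intro mult_right_mono) auto
    finally show "visitation \<gamma> \<pi> s\<^sub>0 Q s / visitation \<gamma> \<pi> s\<^sub>0 P s * g s \<le> ?\<delta> * max 0 (g s)" .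
  qed
  also have "\<dots> = ?\<delta> * (\<Sum>s\<in>UNIV. grad P $ s \<bullet> (R $ s - P $ s))"
    unfolding sum_distrib_left by (intro sum.cong refl) (simp add: R_def g_def max_def)
  also have "(\<Sum>s\<in>UNIV. grad P $ s \<bullet> (R $ s - P $ s)) = grad P \<bullet> R - grad P \<bullet> P"
    by (simp add: inner_diff_right sum_subtractf inner_vec_def[of "grad P"])
  also have "?\<delta> * (grad P \<bullet> R - grad P \<bullet> P) \<le>
      ?\<delta> * ((SUP R\<in>s_rect_hull U. grad P \<bullet> R) - grad P \<bullet> P)"
    using \<delta> cSUP_upper[OF R bdd_above_grad_inner[OF hull_kernel[OF P] s_rect_hull_subset_kernels[OF U(1)]]]
    by (intro mult_left_mono) auto
  finally show ?thesis .
qed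

lemma nonrect_at_le_degree:
  assumes "P \<in> U"
  shows "nonrect_at \<gamma> c \<pi> s\<^sub>0 U P \<le> nonrect_degree \<gamma> c \<pi> s\<^sub>0 U"
proof -
  have "nonrect_at \<gamma> c \<pi> s\<^sub>0 U Q \<le> \<gamma> / (1 - \<gamma>)\<^sup>2" if Q: "Q \<in> U" for Q
  proof -
    have K: "Q \<in> kernels" using Q U by auto
    have "(SUP R\<in>s_rect_hull U. grad Q \<bullet> R) \<le> \<gamma> / (1 - \<gamma>)\<^sup>2"
      using Q subset_s_rect_hull[of U] by (intro cSUP_least grad_inner_range K hull_kernel) auto
    moreover have "0 \<le> grad Q \<bullet> Q" by (rule grad_inner_range[OF K K])
    moreover have "grad Q \<bullet> Q \<le> (SUP R\<in>U. grad Q \<bullet> R)"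
      by (rule cSUP_upper[OF Q bdd_above_grad_inner[OF K U(1)]])
    ultimately show ?thesis by (simp add: nonrect_at_def)
  qed
  then show ?thesis
    unfolding nonrect_degree_def
    by (intro cSUP_upper[OF assms] bdd_aboveI2[where M = "\<gamma> / (1 - \<gamma>)\<^sup>2"])
qed

text \<open>
  Gradient domination bounds the gap in terms of the largest derivative at \<open>P\<close> towards the hull.  That
  exceeds the largest derivative towards \<open>U\<close> by \<open>nonrect_at\<close>, which is at most the degree of non-rectangularity.
\<close>
lemma worst_case_gap_at_stationary_point:
  assumes P: "P \<in> U" and gap: "\<And>Q. Q \<in> U \<Longrightarrow> grad P \<bullet> (Q - P) \<le> \<eta>"
  shows "worst_case_value \<gamma> c \<pi> s\<^sub>0 U - value_fun \<gamma> c \<pi> s\<^sub>0 P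
     \<le> mismatch_coeff \<gamma> \<pi> s\<^sub>0 U * (\<eta> + nonrect_degree \<gamma> c \<pi> s\<^sub>0 U)"
proof -
  let ?\<delta> = "mismatch_coeff \<gamma> \<pi> s\<^sub>0 U"
  have PH: "P \<in> s_rect_hull U" and K: "P \<in> kernels"
    using P U subset_s_rect_hull[of U] by auto
  have fun_ext: "value_fun \<gamma> c \<pi> s\<^sub>0 Q = val Q" if "Q \<in> U" for Q
    using that U by (intro value_fun_eq_value_ext policy discount) auto
  have \<delta>: "0 \<le> ?\<delta>"
    using visitation_ratio_nonneg[OF PH PH] visitation_ratio_le_mismatch[OF PH PH] by (rule order_trans)
  have "(SUP Q\<in>U. grad P \<bullet> Q) \<le> \<eta> + grad P \<bullet> P"
    using P gap by (intro cSUP_least) (auto simp: inner_diff_right algebra_simps)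
  then have "(SUP R\<in>s_rect_hull U. grad P \<bullet> R) - grad P \<bullet> P \<le> \<eta> + nonrect_degree \<gamma> c \<pi> s\<^sub>0 U"
    using nonrect_at_le_degree[OF P] by (simp add: nonrect_at_def)
  then have "?\<delta> * ((SUP R\<in>s_rect_hull U. grad P \<bullet> R) - grad P \<bullet> P) \<le>
      ?\<delta> * (\<eta> + nonrect_degree \<gamma> c \<pi> s\<^sub>0 U)"
    by (rule mult_left_mono[OF _ \<delta>])
  then have "val Q \<le> val P + ?\<delta> * (\<eta> + nonrect_degree \<gamma> c \<pi> s\<^sub>0 U)" if "Q \<in> U" for Q
    using gradient_domination[OF PH, of Q] subset_s_rect_hull[of U] that by fastforce
  then have "worst_case_value \<gamma> c \<pi> s\<^sub>0 U \<le> val P + ?\<delta> * (\<eta> + nonrect_degree \<gamma> c \<pi> s\<^sub>0 U)"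
    unfolding worst_case_value_def using P by (intro cSUP_least) (auto simp: fun_ext)
  then show ?thesis by (simp add: fun_ext[OF P])
qed

end

section \<open>Termination of the algorithm\<close>

text \<open>
  By \<open>frank_wolfe_progress\<close>, every iteration that does not terminate increases the value by a constant,
  \<open>\<rho>\<close> in the proof, and the value stays in \<open>[0, 1 / (1 - \<gamma>)]\<close>.  This needs the next iterate to be a
  kernel: for \<open>\<gamma> \<ge> 1 / 5\<close> the stepsizes lie between 0 and 1, so that convexity keeps the iterates in
  \<open>U\<close>, and for smaller \<open>\<gamma>\<close> feasibility is a hypothesis.
\<close>
lemma fw_iterations_bound:
  assumes U: "U \<subseteq> kernels" "convex U" and \<epsilon>: "0 < \<epsilon>"
    and run: "fw_run \<gamma> c \<pi> s\<^sub>0 U \<alpha> \<epsilon> Pit Peps"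
    and step: "\<And>m. \<alpha> m = fw_objective \<gamma> c \<pi> s\<^sub>0 (Pit m) (Peps m) * (1 - \<gamma>) ^ 3 / (4 * \<gamma>\<^sup>2)"
    and feasible: "\<gamma> < 1 / 5 \<Longrightarrow> fw_feasible \<gamma> c \<pi> s\<^sub>0 U \<epsilon> Pit Peps"
    and reach: "fw_reaches \<gamma> c \<pi> s\<^sub>0 \<epsilon> Pit Peps m"
  shows "Pit m \<in> U \<and> real m \<le> 8 * \<gamma>\<^sup>2 / (1 - \<gamma>) ^ 4 / \<epsilon>\<^sup>2"
proof -
  define \<rho> where "\<rho> = \<epsilon>\<^sup>2 * (1 - \<gamma>) ^ 3 / (8 * \<gamma>\<^sup>2)"
  have \<rho>: "0 < \<rho>" using \<epsilon> discount by (simp add: \<rho>_def)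
  have "Pit m \<in> U \<and> real m * \<rho> \<le> val (Pit m)"
    using reach
  proof (induction m)
    case 0
    have "Pit 0 \<in> U" using run by (simp add: fw_run_def)
    then show ?case using value_range[of "Pit 0"] U by auto
  next
    case (Suc m)
    define G where "G = fw_objective \<gamma> c \<pi> s\<^sub>0 (Pit m) (Peps m)"
    have reach_m: "fw_reaches \<gamma> c \<pi> s\<^sub>0 \<epsilon> Pit Peps m" and G: "\<epsilon> < G"
      using Suc.prems by (auto simp: fw_reaches_def G_def)
    then have IH: "Pit m \<in> U" "real m * \<rho> \<le> val (Pit m)" using Suc.IH by auto
    have dir: "Peps m \<in> U" and upd: "Pit (Suc m) = (1 - \<alpha> m) *\<^sub>R Pit m + \<alpha> m *\<^sub>R Peps m"
      using run reach_m G by (auto simp: fw_run_def eps_optimal_direction_def G_def)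
    have G': "G = grad (Pit m) \<bullet> (Peps m - Pit m)" by (simp add: G_def fw_objective_def)
    have \<alpha>: "\<alpha> m = G * (1 - \<gamma>) ^ 3 / (4 * \<gamma>\<^sup>2)" by (simp add: step G_def)
    have next_in: "Pit (Suc m) \<in> U"
    proof (cases "\<gamma> < 1 / 5")
      case True
      then show ?thesis using feasible Suc.prems by (simp add: fw_feasible_def)
    next
      case False
      have "\<alpha> m \<le> 1"
        unfolding \<alpha> G' using IH dir U False by (intro step_size_le_1) auto
      moreover have "0 \<le> \<alpha> m" unfolding \<alpha> using G \<epsilon> discount by simp
      ultimately show ?thesis
        unfolding upd using IH(1) dir U(2) by (simp add: convexD_alt)
    qed
    have "\<epsilon>\<^sup>2 \<le> G\<^sup>2" using G \<epsilon> by (intro power_mono) auto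
    then have "\<rho> \<le> G\<^sup>2 * (1 - \<gamma>) ^ 3 / (8 * \<gamma>\<^sup>2)"
      unfolding \<rho>_def using discount by (intro divide_right_mono mult_right_mono) auto
    also have "\<dots> \<le> val (Pit (Suc m)) - val (Pit m)"
      using IH dir next_in U by (intro frank_wolfe_progress[OF _ _ _ G' \<alpha> upd]) auto
    finally show ?case using next_in IH(2) by (simp add: algebra_simps)
  qed
  then have m: "Pit m \<in> U" "real m * \<rho> \<le> 1 / (1 - \<gamma>)"
    using value_range[of "Pit m"] U by auto
  then have "real m \<le> 1 / (1 - \<gamma>) / \<rho>" using \<rho> by (subst pos_le_divide_eq)
  also have "\<dots> = 8 * \<gamma>\<^sup>2 / (1 - \<gamma>) ^ 4 / \<epsilon>\<^sup>2"
    by (simp add: \<rho>_def power_numeral_reduce)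
  finally show ?thesis using m by simp
qed

end

lemma affine_image_convex_compact:
  fixes f :: "'v::euclidean_space \<Rightarrow> 'w::real_normed_vector"
  assumes "affine_map_on X f" "convex X" "compact X"
  shows "convex (f ` X)" "compact (f ` X)"
proof -
  obtain L b where L: "linear L" "\<And>x. x \<in> X \<Longrightarrow> f x = L x + b"
    using assms(1) by (auto simp: affine_map_on_def)
  have img: "f ` X = (\<lambda>y. b + y) ` L ` X" using L(2) by (force simp: image_iff add.commute)
  show "convex (f ` X)"
    unfolding img by (intro convex_translation convex_linear_image L(1) assms(2))
  show "compact (f ` X)"
    unfolding img by (intro compact_translation compact_continuous_image linear_continuous_on assms(3)
        linear_conv_bounded_linear[THEN iffD1, OF L(1)])
qed

theorem theorem3p12:
  fixes \<gamma> :: real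
    and c :: "'s::finite \<Rightarrow> 'a::finite \<Rightarrow> real"
    and \<pi> :: "('s, 'a) policy"
    and s\<^sub>0 :: 's
    and \<Xi> :: "(real^'q) set"
    and kern :: "real^'q \<Rightarrow> ('s, 'a) kernel"
    and U :: "('s, 'a) kernel set"
  assumes gamma: "0 < \<gamma>" "\<gamma> < 1"
    and cost: "\<And>s a. 0 \<le> c s a \<and> c s a \<le> 1"
    and policy: "\<pi> \<in> policies"
    and Xi: "convex \<Xi>" "compact \<Xi>"
    and kern_affine: "affine_map_on \<Xi> kern"
    and U_def: "U = kern ` \<Xi>"
    and U_kernels: "U \<subseteq> kernels"
    and irreducible: "\<And>P. P \<in> s_rect_hull U \<Longrightarrow> irreducible_chain P \<pi>"
  shows "\<exists>C. \<forall>\<epsilon>>0. \<forall>\<alpha> Pit Peps.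
           fw_run \<gamma> c \<pi> s\<^sub>0 U \<alpha> \<epsilon> Pit Peps \<longrightarrow>
           (\<forall>m. \<alpha> m = fw_objective \<gamma> c \<pi> s\<^sub>0 (Pit m) (Peps m) * (1 - \<gamma>) ^ 3 / (4 * \<gamma>\<^sup>2)) \<longrightarrow>
           (\<gamma> < 1 / 5 \<longrightarrow> fw_feasible \<gamma> c \<pi> s\<^sub>0 U \<epsilon> Pit Peps) \<longrightarrow>
           (\<exists>m. fw_terminates_at \<gamma> c \<pi> s\<^sub>0 \<epsilon> Pit Peps m \<and>
                real m \<le> C / \<epsilon>\<^sup>2 \<and>
                worst_case_value \<gamma> c \<pi> s\<^sub>0 U - value_fun \<gamma> c \<pi> s\<^sub>0 (Pit m)
                  \<le> mismatch_coeff \<gamma> \<pi> s\<^sub>0 U * (2 * \<epsilon> + nonrect_degree \<gamma> c \<pi> s\<^sub>0 U))"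
proof (intro exI[of _ "8 * \<gamma>\<^sup>2 / (1 - \<gamma>) ^ 4"] allI impI)
  interpret discounted_mdp \<gamma> \<pi> c s\<^sub>0
    by unfold_locales (use gamma cost policy in auto)
  fix \<epsilon> :: real and \<alpha> Pit Peps
  assume \<epsilon>: "0 < \<epsilon>" and run: "fw_run \<gamma> c \<pi> s\<^sub>0 U \<alpha> \<epsilon> Pit Peps"
    and step: "\<forall>m. \<alpha> m = fw_objective \<gamma> c \<pi> s\<^sub>0 (Pit m) (Peps m) * (1 - \<gamma>) ^ 3 / (4 * \<gamma>\<^sup>2)"
    and feasible: "\<gamma> < 1 / 5 \<longrightarrow> fw_feasible \<gamma> c \<pi> s\<^sub>0 U \<epsilon> Pit Peps"
  have U: "convex U" "compact U"
    unfolding U_def by (rule affine_image_convex_compact[OF kern_affine Xi])+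
  let ?reach = "fw_reaches \<gamma> c \<pi> s\<^sub>0 \<epsilon> Pit Peps" and ?G = "\<lambda>m. fw_objective \<gamma> c \<pi> s\<^sub>0 (Pit m) (Peps m)"
  have bound: "Pit m \<in> U \<and> real m \<le> 8 * \<gamma>\<^sup>2 / (1 - \<gamma>) ^ 4 / \<epsilon>\<^sup>2" if "?reach m" for m
    using fw_iterations_bound[OF U_kernels U(1) \<epsilon> run _ _ that] step feasible by blast
  have ex: "\<exists>m. ?G m \<le> \<epsilon>"
  proof (rule ccontr)
    assume "\<nexists>m. ?G m \<le> \<epsilon>"
    then have "?reach m" for m by (auto simp: fw_reaches_def not_le)
    then have "\<forall>m. real m \<le> 8 * \<gamma>\<^sup>2 / (1 - \<gamma>) ^ 4 / \<epsilon>\<^sup>2" using bound by blast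
    then show False by (meson not_le reals_Archimedean2)
  qed
  define m where "m = (LEAST m. ?G m \<le> \<epsilon>)"
  have last: "?G m \<le> \<epsilon>" unfolding m_def using ex by (rule LeastI_ex)
  have reach: "?reach m"
    unfolding fw_reaches_def m_def using not_less_Least by (meson not_le)
  have P: "Pit m \<in> U" using bound[OF reach] by simp
  have K: "Pit m \<in> kernels" using P U_kernels by auto
  have gap: "grad (Pit m) \<bullet> (Q - Pit m) \<le> 2 * \<epsilon>" if Q: "Q \<in> U" for Q
  proof -
    have "bdd_above ((\<lambda>Q. fw_objective \<gamma> c \<pi> s\<^sub>0 (Pit m) Q) ` U)"
      using grad_inner_range(2)[OF K] U_kernels
      by (intro bdd_aboveI2[where M = "\<gamma> / (1 - \<gamma>)\<^sup>2 - grad (Pit m) \<bullet> Pit m"])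
        (auto simp: fw_objective_def inner_diff_right)
    then have "fw_objective \<gamma> c \<pi> s\<^sub>0 (Pit m) Q \<le> (SUP Q\<in>U. fw_objective \<gamma> c \<pi> s\<^sub>0 (Pit m) Q)"
      by (rule cSUP_upper[OF Q])
    also have "\<dots> \<le> ?G m + \<epsilon>"
      using run reach by (auto simp: fw_run_def eps_optimal_direction_def)
    also have "\<dots> \<le> 2 * \<epsilon>" using last by simp
    finally show ?thesis by (simp add: fw_objective_def)
  qed
  have "worst_case_value \<gamma> c \<pi> s\<^sub>0 U - value_fun \<gamma> c \<pi> s\<^sub>0 (Pit m)
      \<le> mismatch_coeff \<gamma> \<pi> s\<^sub>0 U * (2 * \<epsilon> + nonrect_degree \<gamma> c \<pi> s\<^sub>0 U)"
    by (rule worst_case_gap_at_stationary_point[OF U_kernels U(2) irreducible P gap])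
  then show "\<exists>m. fw_terminates_at \<gamma> c \<pi> s\<^sub>0 \<epsilon> Pit Peps m \<and>
      real m \<le> 8 * \<gamma>\<^sup>2 / (1 - \<gamma>) ^ 4 / \<epsilon>\<^sup>2 \<and>
      worst_case_value \<gamma> c \<pi> s\<^sub>0 U - value_fun \<gamma> c \<pi> s\<^sub>0 (Pit m)
        \<le> mismatch_coeff \<gamma> \<pi> s\<^sub>0 U * (2 * \<epsilon> + nonrect_degree \<gamma> c \<pi> s\<^sub>0 U)"
    using reach last bound[OF reach] unfolding fw_terminates_at_def by blast
qed

end
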